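(* Let $T$ be a (plane) rooted tree, viewed as a rooted tree poset. The function $\mathrm{dfs}(T)\mapsto e(T)$ is in $\#\mathsf{L}$.
   Context: $e(T)$ is the number of linear extensions (topological orderings) of the rooted tree poset $T$: bijections from the $n$ nodes of $T$ to $\{1,\dots,n\}$ in which every node receives a smaller label than each of its children. $\mathrm{dfs}(T)\in\{0,1\}^{2(n-1)}$ is the Depth-First-Search traversal of the plane rooted tree $T$ started at the root: each $1$ represents going down an edge away from the root and each $0$ represents returning along an edge towards the root, children being visited left to right. The alphabet is $\Sigma=\{0,1\}$. A function given only on strings of a specified form is extended by $0$ to all other strings. $\#\mathsf{L}$ is the class of functions $f:\Sigma^*\to\mathbb{N}_0$ such that $f(x)$ is the number of accepting computation paths on input $x$ of a fixed nondeterministic Turing machine with read-only input tape that uses $O(\log|x|)$ work space and halts on every computation path. Equivalently: there are a polynomial $q$ and a deterministic $O(\log|x|)$-space Turing machine $M$ with an additional read-once, left-to-right witness tape such that $f(x)=\#\{w\in\Sigma^{q(|x|)}\mid M(x,w)=\mathsf{yes}\}$. *)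

theory Defs
  imports "HOL-Library.FuncSet" "HOL-Library.Landau_Symbols"
begin

section \<open>Plane rooted trees\<close>

datatype ptree = Node "ptree list"

text \<open>\<open>True\<close> stands for 1 (going down an edge), \<open>False\<close> for 0 (returning along it).\<close>

fun dfs :: "ptree \<Rightarrow> bool list" where
  "dfs (Node ts) = concat (map (\<lambda>t. [True] @ dfs t @ [False]) ts)"

lemma dfs_append_cancel:
  assumes "dfs s @ u = dfs t @ v"
    and "u = [] \<or> hd u = False" "v = [] \<or> hd v = False"
  shows "s = t \<and> u = v"
  using assms
proof (induction "length (dfs s)" arbitrary: s t u v rule: less_induct)
  case less
  obtain ss ts where st: "s = Node ss" "t = Node ts"
    by (metis ptree.exhaust)
  show ?case
  proof (cases ss)
    case Nil
    have "ts = []"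
    proof (cases ts)
      case (Cons b bs)
      then show ?thesis using less.prems st Nil by (cases u) auto
    qed
    then show ?thesis using less.prems st Nil by simp
  next
    case (Cons a as)
    show ?thesis
    proof (cases ts)
      case Nil
      then show ?thesis
        using less.prems st Cons by (cases v) auto
    next
      case (Cons b bs)
      have eq: "dfs a @ (False # dfs (Node as) @ u) = dfs b @ (False # dfs (Node bs) @ v)"
        using less.prems(1) st \<open>ss = a # as\<close> Cons by simp
      have "length (dfs a) < length (dfs s)"
        using st \<open>ss = a # as\<close> by simp
      from less.hyps[OF this eq] have 1: "a = b" "dfs (Node as) @ u = dfs (Node bs) @ v"
        by auto
      have "length (dfs (Node as)) < length (dfs s)"
        using st \<open>ss = a # as\<close> by simp
      from less.hyps[OF this 1(2) less.prems(2,3)] show ?thesis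
        using 1 st \<open>ss = a # as\<close> Cons by simp
    qed
  qed
qed

lemma inj_dfs: "inj dfs"
  by (rule injI) (use dfs_append_cancel[where u = "[]" and v = "[]"] in auto)

lemma size_nth_less [termination_simp]: "i < length ts \<Longrightarrow> size (ts ! i) < Suc (size_list size ts)"
  using size_list_estimation'[of "ts ! i" ts "size (ts ! i)" size] by (simp add: less_Suc_eq_le)

text \<open>A node is given by its address: the root is the empty list, and \<open>p @ [i]\<close> is the
  \<open>i\<close>-th child (counted from 0, left to right) of the node \<open>p\<close>.\<close>

fun nodes :: "ptree \<Rightarrow> nat list set" where
  "nodes (Node ts) = insert [] (\<Union>i\<in>{..<length ts}. (#) i ` nodes (ts ! i))"

text \<open>Labellings are taken in \<open>extensional\<close>, so that they are counted as functions on the nodes.\<close>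

definition linear_extensions :: "ptree \<Rightarrow> (nat list \<Rightarrow> nat) set" where
  "linear_extensions T =
     {l \<in> extensional (nodes T).
        bij_betw l (nodes T) {1..card (nodes T)} \<and>
        (\<forall>p i. p \<in> nodes T \<and> p @ [i] \<in> nodes T \<longrightarrow> l p < l (p @ [i]))}"

definition num_linear_extensions :: "ptree \<Rightarrow> nat" where
  "num_linear_extensions T = card (linear_extensions T)"


section \<open>Functions given on encodings only\<close>

definition extend_by_zero :: "('a \<Rightarrow> bool list) \<Rightarrow> ('a \<Rightarrow> nat) \<Rightarrow> bool list \<Rightarrow> nat" where
  "extend_by_zero enc g = (\<lambda>w. if w \<in> range enc then g (inv enc w) else 0)"

lemma extend_by_zero_enc: "inj enc \<Longrightarrow> extend_by_zero enc g (enc a) = g a"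
  by (simp add: extend_by_zero_def)


section \<open>Nondeterministic Turing machines with a read-only input tape\<close>

datatype input_symbol = Left_End | Bit bool | Right_End

datatype direction = Left | Stay | Right

text \<open>The instruction \<open>(q, a, us, q', d, acts)\<close> can be executed in state \<open>q\<close> when the input head
  reads \<open>a\<close> and the heads of the work tapes read \<open>us\<close>. It enters state \<open>q'\<close> and moves the input
  head in direction \<open>d\<close>; \<open>acts\<close> has for each work tape the symbol written and the move of its head.\<close>

type_synonym ('q, 's) instruction =
  "'q \<times> input_symbol \<times> 's list \<times> 'q \<times> direction \<times> ('s \<times> direction) list"

record ('q, 's) ntm =
  num_tapes :: nat
  blank :: 's
  start :: 'q
  accepting :: "'q set"
  instructions :: "('q, 's) instruction set"

text \<open>State and work alphabet of a machine are not given explicitly: by finiteness of the set of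
  instructions, only finitely many states and symbols can ever occur.\<close>

definition ntm_wf :: "('q, 's) ntm \<Rightarrow> bool" where
  "ntm_wf M \<longleftrightarrow>
     finite (instructions M) \<and>
     (\<forall>(q, a, us, q', d, acts) \<in> instructions M.
        length us = num_tapes M \<and> length acts = num_tapes M)"

text \<open>A configuration \<open>(q, h, ws)\<close> consists of the state, the position of the input head and, for
  each work tape, its contents and the position of its head. Work tapes are infinite to the right.\<close>

type_synonym ('q, 's) config = "'q \<times> nat \<times> ((nat \<Rightarrow> 's) \<times> nat) list"

definition initial_config :: "('q, 's) ntm \<Rightarrow> ('q, 's) config" where
  "initial_config M = (start M, 0, replicate (num_tapes M) (\<lambda>_. blank M, 0))"

text \<open>The input is stored in the cells \<open>1, \<dots>, length x\<close>, between two end markers.\<close>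

definition input_at :: "bool list \<Rightarrow> nat \<Rightarrow> input_symbol" where
  "input_at x h =
     (if h = 0 then Left_End else if h \<le> length x then Bit (x ! (h - 1)) else Right_End)"

text \<open>A head in cell 0 that is told to move left stays where it is. The input head, moreover,
  never moves beyond the right end marker.\<close>

fun move :: "direction \<Rightarrow> nat \<Rightarrow> nat" where
  "move Left h = h - 1"
| "move Stay h = h"
| "move Right h = h + 1"

fun enabled :: "bool list \<Rightarrow> ('q, 's) config \<Rightarrow> ('q, 's) instruction \<Rightarrow> bool" where
  "enabled x (q, h, ws) (p, a, us, q', d, acts) \<longleftrightarrow>
     p = q \<and> a = input_at x h \<and> us = map (\<lambda>(tape, pos). tape pos) ws"

fun exec :: "bool list \<Rightarrow> ('q, 's) instruction \<Rightarrow> ('q, 's) config \<Rightarrow> ('q, 's) config" where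
  "exec x (p, a, us, q', d, acts) (q, h, ws) =
     (q', min (move d h) (length x + 1),
      map2 (\<lambda>(tape, pos) (s, e). (tape(pos := s), move e pos)) ws acts)"

definition step :: "('q, 's) ntm \<Rightarrow> bool list \<Rightarrow> ('q, 's) config \<Rightarrow> ('q, 's) config \<Rightarrow> bool" where
  "step M x c c' \<longleftrightarrow> (\<exists>i \<in> instructions M. enabled x c i \<and> c' = exec x i c)"

definition reachable :: "('q, 's) ntm \<Rightarrow> bool list \<Rightarrow> ('q, 's) config \<Rightarrow> bool" where
  "reachable M x c \<longleftrightarrow> (step M x)\<^sup>*\<^sup>* (initial_config M) c"

text \<open>\<open>run M x c \<pi> c'\<close>: executing the instructions \<open>\<pi>\<close> one after the other leads from
  \<open>c\<close> to \<open>c'\<close>.\<close>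

inductive run :: "('q, 's) ntm \<Rightarrow> bool list \<Rightarrow> ('q, 's) config \<Rightarrow> ('q, 's) instruction list
    \<Rightarrow> ('q, 's) config \<Rightarrow> bool" for M x where
  run_Nil: "run M x c [] c"
| run_Cons: "i \<in> instructions M \<Longrightarrow> enabled x c i \<Longrightarrow> run M x (exec x i c) \<pi> c'
    \<Longrightarrow> run M x c (i # \<pi>) c'"

definition halted :: "('q, 's) ntm \<Rightarrow> bool list \<Rightarrow> ('q, 's) config \<Rightarrow> bool" where
  "halted M x c \<longleftrightarrow> (\<nexists>c'. step M x c c')"

text \<open>A computation path is identified with the sequence of the instructions executed along it.\<close>

definition accepting_paths :: "('q, 's) ntm \<Rightarrow> bool list \<Rightarrow> ('q, 's) instruction list set" where
  "accepting_paths M x =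
     {\<pi>. \<exists>c. run M x (initial_config M) \<pi> c \<and> halted M x c \<and> fst c \<in> accepting M}"

definition halts_on_every_path :: "('q, 's) ntm \<Rightarrow> bool list \<Rightarrow> bool" where
  "halts_on_every_path M x \<longleftrightarrow>
     \<not> (\<exists>c :: nat \<Rightarrow> ('q, 's) config.
          c 0 = initial_config M \<and> (\<forall>n. step M x (c n) (c (Suc n))))"

text \<open>Work heads start in cell 0 and move by at most one cell at a time, so the largest head position
  determines the number of cells used.\<close>

definition space_bounded :: "('q, 's) ntm \<Rightarrow> (nat \<Rightarrow> nat) \<Rightarrow> bool" where
  "space_bounded M s \<longleftrightarrow>
     (\<forall>x q h ws. reachable M x (q, h, ws) \<longrightarrow>
        (\<forall>(tape, pos) \<in> set ws. pos < s (length x)))"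

definition logspace :: "('q, 's) ntm \<Rightarrow> bool" where
  "logspace M \<longleftrightarrow>
     (\<exists>s. space_bounded M s \<and> (\<lambda>n. real (s n)) \<in> O(\<lambda>n. ln (real n)))"


section \<open>The class of functions #L\<close>

text \<open>As only finitely many states and symbols occur in a machine, taking them from \<open>nat\<close> is no
  restriction. The set of accepting paths is finite, because the machine is finitely branching
  and has no infinite path.\<close>

definition sharpL :: "(bool list \<Rightarrow> nat) set" where
  "sharpL =
     {f. \<exists>M :: (nat, nat) ntm.
           ntm_wf M \<and> logspace M \<and>
           (\<forall>x. halts_on_every_path M x) \<and>
           (\<forall>x. f x = card (accepting_paths M x))}"

end

theory Submission
  imports Defs "HOL-Library.Countable" "HOL-Library.Log_Nat" "HOL-Library.Sublist"
begin

text \<open>Removing the root of a tree and merging the orderings of the remaining subtrees gives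
  \<open>e(Node (t # ts)) = (|t| + m choose |t|) * e(t) * e(Node ts)\<close>, where \<open>|t|\<close> is the number of nodes
  of \<open>t\<close> and \<open>m\<close> the number of nodes in the trees \<open>ts\<close> (\<open>num_linear_extensions_Cons\<close>). Hence \<open>e(T)\<close> is
  a product of binomial coefficients \<open>a + b choose a\<close>, one for each 1 in the word \<open>dfs T\<close>: this 1 leads
  down to some node, \<open>a\<close> is the size of the subtree at that node, and \<open>b\<close> is the total size of the
  subtrees at its later siblings. Both sizes can be read off from the word. Call the part from the
  given 1 up to the 0 that leaves the parent, or up to the end of the word if the parent is the root,
  the block of this 1. It has \<open>a\<close> ones up to the 0 that matches the given 1, and \<open>b\<close> ones after it.

  A nondeterministic machine realizes a factor as follows. It scans the block and keeps a counter
  \<open>e\<close> that starts at 0. At each of the first \<open>a\<close> ones it guesses whether to increment \<open>e\<close>, at each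
  of the other \<open>b\<close> ones whether to decrement it, and it continues only if \<open>e\<close> ends at 0. Pascal's
  rule shows that there are \<open>a + b choose a\<close> ways to survive (\<open>rest_count_dfs\<close>, \<open>first_count_dfs\<close>,
  \<open>block_count_dfs\<close>). Doing this for all ones one after the other multiplies the factors
  (\<open>total_count_dfs\<close>); a preceding deterministic scan rejects the words that are not of the form
  \<open>dfs T\<close>, which are the unbalanced ones (\<open>balanced_iff\<close>).

  Besides \<open>e\<close>, the machine needs a counter for the depth and one for the way back to the start of
  the block. None of them exceeds the input length, so that they can be kept in binary in logarithmic
  space. The construction is split accordingly: \<open>program\<close> is a program for a nondeterministic machine
  with counters, \<open>program_counts_program\<close> determines its number of accepting computations, and
  \<open>sharpL_program\<close> is a compiler from such programs to Turing machines that preserves this number.\<close>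

section \<open>Counting accepting paths by induction\<close>

text \<open>\<open>counts M x S c k\<close>: every computation path from \<open>c\<close> halts, exactly \<open>k\<close> of them accept, and on
  all of them the work heads stay in the cells below \<open>S\<close>. The inductive definition makes it possible
  to establish all three properties together, backwards along the computation.\<close>

inductive counts :: "('q, 's) ntm \<Rightarrow> bool list \<Rightarrow> nat \<Rightarrow> ('q, 's) config \<Rightarrow> nat \<Rightarrow> bool"
  for M x S where
  counts_halted:
    "\<lbrakk>\<forall>(tape, pos) \<in> set (snd (snd c)). pos < S; {i \<in> instructions M. enabled x c i} = {}\<rbrakk>
      \<Longrightarrow> counts M x S c (of_bool (fst c \<in> accepting M))"
| counts_branch:
    "\<lbrakk>\<forall>(tape, pos) \<in> set (snd (snd c)). pos < S; E = {i \<in> instructions M. enabled x c i}; E \<noteq> {};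
      \<And>i. i \<in> E \<Longrightarrow> counts M x S (exec x i c) (f i)\<rbrakk>
      \<Longrightarrow> counts M x S c (\<Sum>i\<in>E. f i)"

text \<open>The accepting computation paths that start in a given configuration.\<close>

definition paths_from :: "('q, 's) ntm \<Rightarrow> bool list \<Rightarrow> ('q, 's) config \<Rightarrow> ('q, 's) instruction list set" where
  "paths_from M x c = {\<pi>. \<exists>c'. run M x c \<pi> c' \<and> halted M x c' \<and> fst c' \<in> accepting M}"

lemma run_Nil_iff: "run M x c [] c' \<longleftrightarrow> c' = c"
  by (auto intro: run.intros elim: run.cases)

lemma run_Cons_iff:
  "run M x c (i # \<pi>) c' \<longleftrightarrow> i \<in> instructions M \<and> enabled x c i \<and> run M x (exec x i c) \<pi> c'"
  by (auto intro: run.intros elim: run.cases)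

lemma paths_from_halted:
  assumes "{i \<in> instructions M. enabled x c i} = {}"
  shows "paths_from M x c = (if fst c \<in> accepting M then {[]} else {})"
proof -
  have "halted M x c" using assms by (auto simp: halted_def step_def)
  moreover have "run M x c \<pi> c' \<longleftrightarrow> \<pi> = [] \<and> c' = c" for \<pi> c'
    using assms by (cases \<pi>) (auto simp: run_Nil_iff run_Cons_iff)
  ultimately show ?thesis by (auto simp: paths_from_def)
qed

lemma paths_from_branch:
  assumes "E = {i \<in> instructions M. enabled x c i}" "E \<noteq> {}"
  shows "paths_from M x c = (\<Union>i\<in>E. (#) i ` paths_from M x (exec x i c))"
proof -
  have "\<not> halted M x c" using assms unfolding halted_def step_def by blast
  then have "\<pi> \<in> paths_from M x c \<longleftrightarrow> (\<exists>i\<in>E. \<exists>\<rho>. \<pi> = i # \<rho> \<and> \<rho> \<in> paths_from M x (exec x i c))" for \<pi>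
    using assms(1) by (cases \<pi>) (auto simp: paths_from_def run_Nil_iff run_Cons_iff)
  then show ?thesis by (auto simp: image_iff)
qed

lemma counts_paths_from:
  assumes "counts M x S c k" "finite (instructions M)"
  shows "finite (paths_from M x c) \<and> card (paths_from M x c) = k"
  using assms(1)
proof induction
  case (counts_halted c)
  then show ?case by (simp add: paths_from_halted)
next
  case (counts_branch c E f)
  have fin: "finite E" using counts_branch.hyps(2) assms(2) by simp
  have "card (\<Union>i\<in>E. (#) i ` paths_from M x (exec x i c))
      = (\<Sum>i\<in>E. card ((#) i ` paths_from M x (exec x i c)))"
    by (rule card_UN_disjoint) (use fin counts_branch.IH in auto)
  also have "\<dots> = (\<Sum>i\<in>E. f i)"
    using counts_branch.IH by (intro sum.cong) (simp_all add: card_image)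
  finally show ?case
    unfolding paths_from_branch[OF counts_branch.hyps(2,3)] using fin counts_branch.IH by auto
qed

lemma counts_no_infinite_path:
  assumes "counts M x S c k"
  shows "\<not> (\<exists>f :: nat \<Rightarrow> _. f 0 = c \<and> (\<forall>n. step M x (f n) (f (Suc n))))"
  using assms
proof induction
  case (counts_halted c)
  have "\<not> step M x c c'" for c'
    using counts_halted.hyps(2) unfolding step_def by blast
  then show ?case by metis
next
  case (counts_branch c E g)
  show ?case
  proof
    assume "\<exists>f :: nat \<Rightarrow> _. f 0 = c \<and> (\<forall>n. step M x (f n) (f (Suc n)))"
    then obtain f :: "nat \<Rightarrow> _" where f: "f 0 = c" "\<And>n. step M x (f n) (f (Suc n))" by blast
    then obtain i where "i \<in> E" "f 1 = exec x i c"
      using counts_branch.hyps(2) f(2)[of 0] by (auto simp: step_def)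
    moreover have "\<exists>g. g 0 = f 1 \<and> (\<forall>n. step M x (g n) (g (Suc n)))"
      by (rule exI[of _ "\<lambda>n. f (Suc n)"]) (use f in simp)
    ultimately show False using counts_branch.IH[of i] by metis
  qed
qed

lemma counts_space:
  assumes "(step M x)\<^sup>*\<^sup>* c c'" "counts M x S c k"
  shows "\<forall>(tape, pos) \<in> set (snd (snd c')). pos < S"
proof -
  from assms have "\<exists>k'. counts M x S c' k'"
  proof (induction rule: rtranclp_induct)
    case (step d d')
    then obtain k' where "counts M x S d k'" by blast
    then show ?case using \<open>step M x d d'\<close>
      unfolding step_def by cases blast+
  qed blast
  then show ?thesis by (auto elim: counts.cases)
qed

lemma sharpL_I:
  fixes M :: "(nat, nat) ntm"
  assumes wf: "ntm_wf M"
    and s: "(\<lambda>n. real (s n)) \<in> O(\<lambda>n. ln (real n))"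
    and M: "\<And>x. counts M x (s (length x)) (initial_config M) (f x)"
  shows "f \<in> sharpL"
proof -
  have "space_bounded M s"
    unfolding space_bounded_def reachable_def using counts_space[OF _ M] by fastforce
  then have "logspace M" using s unfolding logspace_def by blast
  moreover have "halts_on_every_path M x" for x
    using counts_no_infinite_path[OF M[of x]] by (simp add: halts_on_every_path_def)
  moreover have "f x = card (accepting_paths M x)" for x
    using counts_paths_from[OF M[of x]] wf
    by (simp add: ntm_wf_def accepting_paths_def paths_from_def)
  ultimately show ?thesis using wf unfolding sharpL_def by blast
qed

section \<open>Counter programs\<close>

text \<open>Programs for a machine with a two-way read-only input head and counters that hold natural numbers.
  A program assigns a command to each label. \<open>Read\<close> branches on the symbol under the input head,
  \<open>Choose\<close> is a nondeterministic choice, and \<open>Dec c l1 l2\<close> goes to \<open>l1\<close> if counter \<open>c\<close> is zero, and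
  otherwise decrements it and goes to \<open>l2\<close>. \<open>Halt b\<close> accepts if and only if \<open>b\<close> holds.\<close>

datatype 'l cmd =
    Read "input_symbol \<Rightarrow> 'l"
  | Move direction 'l
  | Choose 'l 'l
  | Inc nat 'l
  | Dec nat 'l 'l
  | Halt bool

text \<open>The analogue of \<open>counts\<close> for programs: from label \<open>l\<close>, input position \<open>h\<close> and counter contents \<open>ns\<close>,
  every computation halts, exactly \<open>n\<close> of them accept, and no counter is ever incremented beyond \<open>N\<close>.
  The two targets of \<open>Choose\<close> have to differ: equal ones would give a single step of a Turing machine.\<close>

inductive program_counts :: "('l \<Rightarrow> 'l cmd) \<Rightarrow> bool list \<Rightarrow> nat \<Rightarrow> 'l \<Rightarrow> nat \<Rightarrow> nat list \<Rightarrow> nat \<Rightarrow> bool"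
  for P x N where
  Read: "P l = Read f \<Longrightarrow> program_counts P x N (f (input_at x h)) h ns n \<Longrightarrow> program_counts P x N l h ns n"
| Move: "P l = Move d l' \<Longrightarrow> program_counts P x N l' (min (move d h) (length x + 1)) ns n
    \<Longrightarrow> program_counts P x N l h ns n"
| Choose: "P l = Choose l1 l2 \<Longrightarrow> l1 \<noteq> l2 \<Longrightarrow> program_counts P x N l1 h ns n1 \<Longrightarrow> program_counts P x N l2 h ns n2
    \<Longrightarrow> program_counts P x N l h ns (n1 + n2)"
| Inc: "P l = Inc c l' \<Longrightarrow> c < length ns \<Longrightarrow> ns ! c < N \<Longrightarrow> program_counts P x N l' h (ns[c := Suc (ns ! c)]) n
    \<Longrightarrow> program_counts P x N l h ns n"
| Dec_zero: "P l = Dec c l1 l2 \<Longrightarrow> c < length ns \<Longrightarrow> ns ! c = 0 \<Longrightarrow> program_counts P x N l1 h ns n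
    \<Longrightarrow> program_counts P x N l h ns n"
| Dec: "P l = Dec c l1 l2 \<Longrightarrow> c < length ns \<Longrightarrow> ns ! c \<noteq> 0
    \<Longrightarrow> program_counts P x N l2 h (ns[c := ns ! c - 1]) n \<Longrightarrow> program_counts P x N l h ns n"
| Halt: "P l = Halt b \<Longrightarrow> program_counts P x N l h ns (of_bool b)"

section \<open>Compilation of counter programs\<close>

text \<open>Each counter has its own work tape. Cell 0 carries the end marker \<open>3\<close>; the following cells contain
  the binary digits of the counter, least significant first, with \<open>1\<close> for the digit zero and \<open>2\<close> for
  the digit one; \<open>0\<close> is the blank. Between commands all work heads are in cell 0.

  \<open>Init\<close> writes the end markers, and \<open>At l\<close> starts the command at \<open>l\<close>. While the command at \<open>l\<close> is an
  increment, \<open>Carry l\<close> propagates the carry; while it is a decrement, \<open>Borrow l\<close> propagates the borrow.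
  Both end in \<open>Return l\<close>, which moves the head back to the marker. If the borrow runs into the blank,
  the counter was zero, and \<open>Restore l\<close> resets the digits to zero on the way back.\<close>

datatype 'l state = Init | At 'l | Carry 'l | Borrow 'l | Return 'l | Restore 'l

instance state :: (finite) finite
proof
  let ?R = "insert Init (range At \<union> range Carry \<union> range Borrow \<union> range Return \<union> range Restore)"
  have "q \<in> ?R" for q :: "'a state" by (cases q) auto
  then show "finite (UNIV :: 'a state set)" by (intro finite_subset[of UNIV ?R]) auto
qed

text \<open>Actions that leave the tapes with symbols \<open>us\<close> under their heads unchanged.\<close>

abbreviation keep :: "nat list \<Rightarrow> (nat \<times> direction) list" where
  "keep us \<equiv> map (\<lambda>s. (s, Stay)) us"

text \<open>\<open>succs P l0 q a us\<close> is the set of all triples of new state, move of the input head and actions on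
  the work tapes that are possible in state \<open>q\<close> on input symbol \<open>a\<close> and work symbols \<open>us\<close>.\<close>

fun succs :: "('l \<Rightarrow> 'l cmd) \<Rightarrow> 'l \<Rightarrow> 'l state \<Rightarrow> input_symbol \<Rightarrow> nat list
    \<Rightarrow> ('l state \<times> direction \<times> (nat \<times> direction) list) set" where
  "succs P l0 Init a us = {(At l0, Stay, map (\<lambda>_. (3, Stay)) us)}"
| "succs P l0 (At l) a us = (case P l of
     Read f \<Rightarrow> {(At (f a), Stay, keep us)}
   | Move d l' \<Rightarrow> {(At l', d, keep us)}
   | Choose l1 l2 \<Rightarrow> {(At l1, Stay, keep us), (At l2, Stay, keep us)}
   | Inc c l' \<Rightarrow> {(Carry l, Stay, (keep us)[c := (us ! c, Right)])}
   | Dec c l1 l2 \<Rightarrow> {(Borrow l, Stay, (keep us)[c := (us ! c, Right)])}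
   | Halt b \<Rightarrow> {})"
| "succs P l0 (Carry l) a us = (case P l of
     Inc c l' \<Rightarrow>
       if us ! c = 2 then {(Carry l, Stay, (keep us)[c := (1, Right)])}
       else {(Return l, Stay, (keep us)[c := (2, Left)])}
   | _ \<Rightarrow> {})"
| "succs P l0 (Borrow l) a us = (case P l of
     Dec c l1 l2 \<Rightarrow>
       if us ! c = 1 then {(Borrow l, Stay, (keep us)[c := (2, Right)])}
       else if us ! c = 2 then {(Return l, Stay, (keep us)[c := (1, Left)])}
       else {(Restore l, Stay, (keep us)[c := (us ! c, Left)])}
   | _ \<Rightarrow> {})"
| "succs P l0 (Return l) a us = (case P l of
     Inc c l' \<Rightarrow>
       if us ! c = 3 then {(At l', Stay, keep us)}
       else {(Return l, Stay, (keep us)[c := (us ! c, Left)])}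
   | Dec c l1 l2 \<Rightarrow>
       if us ! c = 3 then {(At l2, Stay, keep us)}
       else {(Return l, Stay, (keep us)[c := (us ! c, Left)])}
   | _ \<Rightarrow> {})"
| "succs P l0 (Restore l) a us = (case P l of
     Dec c l1 l2 \<Rightarrow>
       if us ! c = 3 then {(At l1, Stay, keep us)}
       else {(Restore l, Stay, (keep us)[c := (1, Left)])}
   | _ \<Rightarrow> {})"

text \<open>The labels form a finite type, so the states can be numbered by \<open>to_nat\<close>.\<close>

definition compile :: "('l::finite \<Rightarrow> 'l cmd) \<Rightarrow> 'l \<Rightarrow> nat \<Rightarrow> (nat, nat) ntm" where
  "compile P l0 k =
     \<lparr>num_tapes = k, blank = 0, start = to_nat (Init :: 'l state),
      accepting = {to_nat (At l) | l. P l = Halt True},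
      instructions = (\<Union>q. \<Union>a. \<Union>us \<in> {us. set us \<subseteq> {..3} \<and> length us = k}.
        (\<lambda>(q', d, acts). (to_nat q, a, us, to_nat q', d, acts)) ` succs P l0 q a us)\<rparr>"

lemma finite_succs: "finite (succs P l0 q a us)"
  by (cases q) (auto split: cmd.splits)

lemma length_succs: "(q', d, acts) \<in> succs P l0 q a us \<Longrightarrow> length acts = length us"
  by (cases q) (auto split: cmd.splits if_splits)

lemma finite_input_symbols: "finite (UNIV :: input_symbol set)"
proof -
  have "a \<in> insert Left_End (insert Right_End (range Bit))" for a by (cases a) auto
  then show ?thesis by (intro finite_subset[of UNIV "insert Left_End (insert Right_End (range Bit))"]) auto
qed

lemma instructions_compile_iff:
  fixes P :: "'l::finite \<Rightarrow> 'l cmd"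
  shows "(p, a, us, p', d, acts) \<in> instructions (compile P l0 k) \<longleftrightarrow>
    (\<exists>q q'. p = to_nat q \<and> p' = to_nat q' \<and> set us \<subseteq> {..3} \<and> length us = k \<and>
      (q', d, acts) \<in> succs P l0 q a us)"
  by (force simp: compile_def)

lemma ntm_wf_compile: "ntm_wf (compile P l0 k)"
proof -
  have "finite {us. set us \<subseteq> {..3::nat} \<and> length us = k}"
    by (simp add: finite_lists_length_eq)
  then have "finite (instructions (compile P l0 k))"
    unfolding compile_def using finite_input_symbols by (simp add: finite_succs)
  moreover have "length us = num_tapes (compile P l0 k) \<and> length acts = num_tapes (compile P l0 k)"
    if "(q, a, us, q', d, acts) \<in> instructions (compile P l0 k)" for q a us q' d acts
    using that length_succs unfolding instructions_compile_iff by (fastforce simp: compile_def)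
  ultimately show ?thesis unfolding ntm_wf_def by blast
qed

lemma enabled_compile:
  fixes P :: "'l::finite \<Rightarrow> 'l cmd"
  assumes "length ws = k" "\<forall>(tape, pos) \<in> set ws. tape pos \<le> 3"
    and us: "us = map (\<lambda>(tape, pos). tape pos) ws"
  shows "{i \<in> instructions (compile P l0 k). enabled x (to_nat q, h, ws) i} =
    (\<lambda>(q', d, acts). (to_nat q, input_at x h, us, to_nat q', d, acts)) ` succs P l0 q (input_at x h) us"
    (is "?L = ?R")
proof -
  have *: "set us \<subseteq> {..3}" "length us = k" using assms by auto
  have "(p, a, vs, p', d, acts) \<in> ?L \<longleftrightarrow> (p, a, vs, p', d, acts) \<in> ?R" for p a vs p' d acts
  proof -
    have "(p, a, vs, p', d, acts) \<in> ?L \<longleftrightarrow> p = to_nat q \<and> a = input_at x h \<and> vs = us \<and>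
        (\<exists>q'. p' = to_nat q' \<and> (q', d, acts) \<in> succs P l0 q a us)"
      unfolding mem_Collect_eq instructions_compile_iff enabled.simps us[symmetric]
      using * by auto
    also have "\<dots> \<longleftrightarrow> (p, a, vs, p', d, acts) \<in> ?R" by force
    finally show ?thesis .
  qed
  then show ?thesis unfolding set_eq_iff split_paired_All by blast
qed

text \<open>The side conditions on the work tapes under which a single step can be analysed.\<close>

definition well_placed :: "nat \<Rightarrow> nat \<Rightarrow> ((nat \<Rightarrow> nat) \<times> nat) list \<Rightarrow> bool" where
  "well_placed k S ws \<longleftrightarrow> length ws = k \<and> (\<forall>(tape, pos) \<in> set ws. tape pos \<le> 3 \<and> pos < S)"

text \<open>One step of a compiled program. Distinct elements of \<open>succs\<close> give distinct instructions, hence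
  the number of accepting paths is the sum over \<open>succs\<close>.\<close>

lemma counts_compile:
  fixes P :: "'l::finite \<Rightarrow> 'l cmd"
  assumes ws: "well_placed k S ws"
    and us: "us = map (\<lambda>(tape, pos). tape pos) ws"
    and ne: "succs P l0 q (input_at x h) us \<noteq> {}"
    and IH: "\<And>q' d acts. (q', d, acts) \<in> succs P l0 q (input_at x h) us \<Longrightarrow>
      counts (compile P l0 k) x S (to_nat q', min (move d h) (length x + 1),
        map2 (\<lambda>(tape, pos) (s, e). (tape(pos := s), move e pos)) ws acts) (f (q', d, acts))"
  shows "counts (compile P l0 k) x S (to_nat q, h, ws) (\<Sum>t\<in>succs P l0 q (input_at x h) us. f t)"
proof -
  let ?g = "\<lambda>(q', d, acts). (to_nat (q :: 'l state), input_at x h, us, to_nat (q' :: 'l state), d, acts)"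
  let ?f = "\<lambda>(p, a, us, q', d, acts). f (from_nat q', d, acts)"
  have inj: "inj_on ?g A" for A by (auto simp: inj_on_def)
  have fg: "?f (?g t) = f t" for t by (cases t) simp
  have "counts (compile P l0 k) x S (to_nat q, h, ws) (\<Sum>i\<in>?g ` succs P l0 q (input_at x h) us. ?f i)"
  proof (rule counts_branch)
    show "\<forall>(tape, pos)\<in>set (snd (snd (to_nat q, h, ws))). pos < S"
      using ws by (auto simp: well_placed_def)
    show "?g ` succs P l0 q (input_at x h) us = {i \<in> instructions (compile P l0 k). enabled x (to_nat q, h, ws) i}"
      using ws by (intro enabled_compile[symmetric] us) (auto simp: well_placed_def)
    show "counts (compile P l0 k) x S (exec x i (to_nat q, h, ws)) (?f i)"
      if "i \<in> ?g ` succs P l0 q (input_at x h) us" for i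
      using that IH by auto
  qed (use ne in simp)
  then show ?thesis by (simp only: sum.reindex[OF inj] o_def fg)
qed

lemma map2_keep: "map2 (\<lambda>(tape, pos) (s, e). (tape(pos := s), move e pos)) ws
    (keep (map (\<lambda>(tape, pos). tape pos) ws)) = ws"
  by (induction ws) auto

lemma map2_keep_update:
  "map2 (\<lambda>(tape, pos) (s, e). (tape(pos := s), move e pos)) (ws[c := (tape, pos)])
     ((keep (map (\<lambda>(tape, pos). tape pos) (ws[c := (tape, pos)])))[c := (s, e)])
   = ws[c := (tape(pos := s), move e pos)]"
proof (induction ws arbitrary: c)
  case (Cons w ws)
  then show ?case
    using map2_keep[of ws] by (cases c; cases w) (simp_all del: map_map fun_upd_apply)
qed simp

lemma counts_keep:
  fixes P :: "'l::finite \<Rightarrow> 'l cmd"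
  assumes "well_placed k S ws"
    and "succs P l0 q (input_at x h) (map (\<lambda>(tape, pos). tape pos) ws)
      = {(q', d, keep (map (\<lambda>(tape, pos). tape pos) ws))}"
    and "counts (compile P l0 k) x S (to_nat q', min (move d h) (length x + 1), ws) n"
  shows "counts (compile P l0 k) x S (to_nat q, h, ws) n"
  using counts_compile[OF assms(1) refl, of P l0 q x h "\<lambda>_. n"] assms(2,3)
  by (simp add: map2_keep del: map_map)

text \<open>A deterministic step in which only the head of work tape \<open>c\<close> acts.\<close>

lemma counts_update:
  fixes P :: "'l::finite \<Rightarrow> 'l cmd"
  assumes "well_placed k S (ws[c := (tape, pos)])" "h \<le> length x + 1"
    and "succs P l0 q (input_at x h) (map (\<lambda>(tape, pos). tape pos) (ws[c := (tape, pos)]))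
      = {(q', Stay, (keep (map (\<lambda>(tape, pos). tape pos) (ws[c := (tape, pos)])))[c := (s, e)])}"
    and "counts (compile P l0 k) x S (to_nat q', h, ws[c := (tape(pos := s), move e pos)]) n"
  shows "counts (compile P l0 k) x S (to_nat q, h, ws[c := (tape, pos)]) n"
proof -
  have [simp]: "min h (Suc (length x)) = h" using assms(2) by simp
  show ?thesis
    using counts_compile[OF assms(1) refl, of P l0 q x h "\<lambda>_. n"] assms(3,4)
    by (simp add: map2_keep_update del: map_map)
qed

section \<open>Binary counters\<close>

definition bit_symbol :: "bool \<Rightarrow> nat" where
  "bit_symbol b = (if b then 2 else 1)"

text \<open>The work tape that stores the given binary digits, least significant first.\<close>

definition bits_tape :: "bool list \<Rightarrow> nat \<Rightarrow> nat" where
  "bits_tape bs i = (case i of 0 \<Rightarrow> 3 | Suc j \<Rightarrow> if j < length bs then bit_symbol (bs ! j) else 0)"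

abbreviation bits_val :: "bool list \<Rightarrow> nat" where
  "bits_val \<equiv> horner_sum of_bool 2"

text \<open>Increment and decrement on digit lists. An increment may add a digit, but a decrement does not
  remove leading zeros; \<open>decr\<close> is meaningful only if the value is not zero.\<close>

fun incr :: "bool list \<Rightarrow> bool list" where
  "incr [] = [True]"
| "incr (False # bs) = True # bs"
| "incr (True # bs) = False # incr bs"

fun decr :: "bool list \<Rightarrow> bool list" where
  "decr [] = []"
| "decr (False # bs) = True # decr bs"
| "decr (True # bs) = False # bs"

lemma bits_val_incr: "bits_val (incr bs) = Suc (bits_val bs)"
  by (induction bs rule: incr.induct) simp_all

lemma bits_val_decr: "bits_val bs \<noteq> 0 \<Longrightarrow> bits_val (decr bs) = bits_val bs - 1"
  by (induction bs rule: decr.induct) auto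

lemma length_decr [simp]: "length (decr bs) = length bs"
  by (induction bs rule: decr.induct) auto

lemma length_incr:
  "length (incr bs) = length bs \<or>
    length (incr bs) = Suc (length bs) \<and> bits_val (incr bs) = 2 ^ length bs"
  by (induction bs rule: incr.induct) auto

text \<open>Leading zeros do no harm to the space bound: a digit is added only if the new value
  needs it.\<close>

lemma length_incr_le:
  assumes "length bs \<le> K" "bits_val bs < N" "N < 2 ^ K"
  shows "length (incr bs) \<le> K"
proof (cases "length (incr bs) = length bs")
  case False
  then have "length (incr bs) = Suc (length bs)" "2 ^ length bs = Suc (bits_val bs)"
    using length_incr[of bs] by (auto simp: bits_val_incr)
  moreover from this have "(2::nat) ^ length bs < 2 ^ K" using assms by linarith
  moreover from this have "length bs < K" by (rule power_less_imp_less_exp[rotated]) simp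
  ultimately show ?thesis by simp
qed (use assms in simp)

lemma bits_val_zero: "bits_val bs = 0 \<longleftrightarrow> bs = replicate (length bs) False"
  by (induction bs) auto

lemma bits_tape_simps [simp]:
  "bits_tape bs 0 = 3"
  "bits_tape bs (Suc (length bs)) = 0"
  "bits_tape (ps @ b # bs) (Suc (length ps)) = bit_symbol b"
  by (simp_all add: bits_tape_def)

lemma bits_tape_update [simp]:
  "(bits_tape (ps @ a # bs))(Suc (length ps) := bit_symbol b) = bits_tape (ps @ b # bs)"
  "(bits_tape ps)(Suc (length ps) := bit_symbol b) = bits_tape (ps @ [b])"
  by (auto simp: fun_eq_iff bits_tape_def nth_append nth_Cons' split: nat.split)

lemma bits_tape_le: "bits_tape bs i \<le> 3"
  by (auto simp: bits_tape_def bit_symbol_def split: nat.splits)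

text \<open>The work tapes between two commands.\<close>

definition at_rest :: "bool list list \<Rightarrow> ((nat \<Rightarrow> nat) \<times> nat) list" where
  "at_rest bss = map (\<lambda>bs. (bits_tape bs, 0)) bss"

lemma length_at_rest [simp]: "length (at_rest bss) = length bss"
  by (simp add: at_rest_def)

lemma at_rest_update:
  "at_rest (bss[c := bs]) = (at_rest bss)[c := (bits_tape bs, 0)]"
  by (simp add: at_rest_def map_update)

lemma well_placed_at_rest:
  "length bss = k \<Longrightarrow> well_placed k (K + 2) (at_rest bss)"
  by (auto simp: well_placed_def at_rest_def bits_tape_le)

lemma well_placed_at_rest_update:
  assumes "length bss = k" "pos < S"
  shows "well_placed k S ((at_rest bss)[c := (bits_tape bs, pos)])"
proof -
  have "tape i \<le> 3 \<and> i < S" if "(tape, i) \<in> set ((at_rest bss)[c := (bits_tape bs, pos)])" for tape i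
  proof -
    have "(tape, i) = (bits_tape bs, pos) \<or> (tape, i) \<in> set (at_rest bss)"
      using that set_update_subset_insert by fast
    then show ?thesis using assms(2) by (auto simp: at_rest_def bits_tape_le)
  qed
  then show ?thesis using assms(1) unfolding well_placed_def by auto
qed

context
  fixes P :: "'l::finite \<Rightarrow> 'l cmd" and l0 :: 'l and k K h c :: nat and x :: "bool list"
    and bss :: "bool list list"
  assumes k: "length bss = k" and c: "c < k" and h: "h \<le> length x + 1"
begin

text \<open>Command on counter \<open>c\<close>: in \<open>focus bs pos\<close>, all tapes are at rest except that tape \<open>c\<close> carries the
  digits \<open>bs\<close> and has its head in cell \<open>pos\<close>.\<close>

private abbreviation (input) M where "M \<equiv> compile P l0 k"
private abbreviation (input) focus where
  "focus bs pos \<equiv> (at_rest bss)[c := (bits_tape bs, pos)]"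
private abbreviation (input) symbols where
  "symbols bs pos \<equiv> map (\<lambda>(tape, pos). tape pos) (focus bs pos)"

private lemma symbols_c [simp]: "symbols bs pos ! c = bits_tape bs pos"
  using k c by simp

private lemma counts_focus:
  assumes "pos < K + 2"
    and "succs P l0 q (input_at x h) (symbols bs pos)
      = {(q', Stay, (keep (symbols bs pos))[c := (s, e)])}"
    and "(bits_tape bs)(pos := s) = bits_tape bs'"
    and "counts M x (K + 2) (to_nat q', h, focus bs' (move e pos)) n"
  shows "counts M x (K + 2) (to_nat q, h, focus bs pos) n"
  using counts_update[OF well_placed_at_rest_update[OF k assms(1)] h assms(2)] assms(3,4) by simp

private lemma counts_leave:
  assumes "succs P l0 q (input_at x h) (symbols bs 0) = {(q', Stay, keep (symbols bs 0))}"
    and "counts M x (K + 2) (to_nat q', h, focus bs 0) n"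
  shows "counts M x (K + 2) (to_nat q, h, focus bs 0) n"
  using counts_keep[OF well_placed_at_rest_update[OF k] assms(1), of "K + 2"] assms(2) h
  by (simp add: min_def)

private lemma counts_return:
  assumes "P l = Inc c l' \<or> P l = Dec c l1 l'" "pos \<le> length bs" "length bs \<le> K"
    and "counts M x (K + 2) (to_nat (At l'), h, focus bs 0) n"
  shows "counts M x (K + 2) (to_nat (Return l), h, focus bs pos) n"
  using assms(2)
proof (induction pos)
  case 0
  show ?case
    by (rule counts_leave[OF _ assms(4)]) (use assms(1) symbols_c[of bs 0] in auto)
next
  case (Suc pos)
  have no_marker: "bits_tape bs (Suc pos) \<noteq> 3"
    using Suc.prems by (auto simp: bits_tape_def bit_symbol_def)
  show ?case
    by (rule counts_focus[where s = "bits_tape bs (Suc pos)" and e = Left and bs' = bs and q' = "Return l"])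
      (use Suc no_marker assms(1,3) symbols_c[of bs "Suc pos"] in auto)
qed

text \<open>In this lemma and the next, \<open>ps\<close> are the digits that have already been rewritten.\<close>

private lemma counts_carry:
  assumes "P l = Inc c l'" "length (ps @ incr bs) \<le> K"
    and "counts M x (K + 2) (to_nat (At l'), h, focus (ps @ incr bs) 0) n"
  shows "counts M x (K + 2) (to_nat (Carry l), h, focus (ps @ bs) (Suc (length ps))) n"
  using assms(2,3)
proof (induction bs arbitrary: ps rule: incr.induct)
  case 1
  show ?case
    by (rule counts_focus[where s = 2 and e = Left and bs' = "ps @ [True]" and q' = "Return l"])
      (use 1 assms(1) symbols_c[of ps "Suc (length ps)"] bits_tape_update(2)[of ps True]
        in \<open>auto simp: bit_symbol_def simp del: add_2_eq_Suc' intro!: counts_return[OF disjI1[OF assms(1)]]\<close>)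
next
  case (2 bs)
  show ?case
    by (rule counts_focus[where s = 2 and e = Left and bs' = "ps @ True # bs" and q' = "Return l"])
      (use 2 assms(1) symbols_c[of "ps @ False # bs" "Suc (length ps)"]
          bits_tape_update(1)[of ps False bs True]
        in \<open>auto simp: bit_symbol_def simp del: add_2_eq_Suc' intro!: counts_return[OF disjI1[OF assms(1)]]\<close>)
next
  case (3 bs)
  show ?case
    by (rule counts_focus[where s = 1 and e = Right and bs' = "ps @ False # bs" and q' = "Carry l"])
      (use 3 "3.IH"[of "ps @ [False]"] assms(1) symbols_c[of "ps @ True # bs" "Suc (length ps)"]
          bits_tape_update(1)[of ps True bs False]
        in \<open>auto simp: bit_symbol_def\<close>)
qed

private lemma counts_borrow:
  assumes "P l = Dec c l1 l2" "length (ps @ bs) \<le> K" "bits_val bs \<noteq> 0"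
    and "counts M x (K + 2) (to_nat (At l2), h, focus (ps @ decr bs) 0) n"
  shows "counts M x (K + 2) (to_nat (Borrow l), h, focus (ps @ bs) (Suc (length ps))) n"
  using assms(2-)
proof (induction bs arbitrary: ps rule: decr.induct)
  case (2 bs)
  show ?case
    by (rule counts_focus[where s = 2 and e = Right and bs' = "ps @ True # bs" and q' = "Borrow l"])
      (use 2 "2.IH"[of "ps @ [True]"] assms(1) symbols_c[of "ps @ False # bs" "Suc (length ps)"]
          bits_tape_update(1)[of ps False bs True]
        in \<open>auto simp: bit_symbol_def\<close>)
next
  case (3 bs)
  show ?case
    by (rule counts_focus[where s = 1 and e = Left and bs' = "ps @ False # bs" and q' = "Return l"])
      (use 3 assms(1) symbols_c[of "ps @ True # bs" "Suc (length ps)"]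
          bits_tape_update(1)[of ps True bs False]
        in \<open>auto simp: bit_symbol_def simp del: add_2_eq_Suc' intro!: counts_return[OF disjI2[OF assms(1)]]\<close>)
qed simp

text \<open>Here \<open>m\<close> digits have not been reset yet.\<close>

private lemma counts_restore:
  assumes "P l = Dec c l1 l2" "m + j \<le> K"
    and "counts M x (K + 2) (to_nat (At l1), h, focus (replicate (m + j) False) 0) n"
  shows "counts M x (K + 2) (to_nat (Restore l), h,
    focus (replicate m True @ replicate j False) m) n"
  using assms(2,3)
proof (induction m arbitrary: j)
  case 0
  show ?case
    by (rule counts_leave[where q' = "At l1"])
      (use 0 assms(1) symbols_c[of "replicate j False" 0] in auto)
next
  case (Suc m)
  have *: "replicate (Suc m) True @ replicate j False = replicate m True @ True # replicate j False"
    by (simp add: replicate_app_Cons_same)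
  have read: "bits_tape (replicate m True @ True # replicate j False) (Suc m) = 2"
    using bits_tape_simps(3)[of "replicate m True" True "replicate j False"]
    by (simp add: bit_symbol_def)
  have written: "(bits_tape (replicate m True @ True # replicate j False))(Suc m := 1)
      = bits_tape (replicate m True @ replicate (Suc j) False)"
    using bits_tape_update(1)[of "replicate m True" True "replicate j False" False]
    by (simp add: bit_symbol_def)
  show ?case
    unfolding *
    by (rule counts_focus[where s = 1 and e = Left and q' = "Restore l"
          and bs' = "replicate m True @ replicate (Suc j) False"])
      (use read written Suc.prems Suc.IH[of "Suc j"] assms(1)
          symbols_c[of "replicate m True @ True # replicate j False" "Suc m"] in auto)
qed

text \<open>If the counter is zero, the borrow turns all digits into ones before it reaches the blank.\<close>

private lemma counts_borrow_zero:
  assumes "P l = Dec c l1 l2" "m + j \<le> K"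
    and "counts M x (K + 2) (to_nat (At l1), h, focus (replicate (m + j) False) 0) n"
  shows "counts M x (K + 2) (to_nat (Borrow l), h,
    focus (replicate m True @ replicate j False) (Suc m)) n"
  using assms(2,3)
proof (induction j arbitrary: m)
  case 0
  have read: "bits_tape (replicate m True) (Suc m) = 0"
    using bits_tape_simps(2)[of "replicate m True"] by simp
  show ?case
    by (rule counts_focus[where s = 0 and e = Left and q' = "Restore l" and bs' = "replicate m True"])
      (use read 0 assms(1) counts_restore[OF assms(1), of m 0 n] symbols_c[of "replicate m True" "Suc m"]
        in auto)
next
  case (Suc j)
  have read: "bits_tape (replicate m True @ False # replicate j False) (Suc m) = 1"
    using bits_tape_simps(3)[of "replicate m True" False "replicate j False"]
    by (simp add: bit_symbol_def)
  have written: "(bits_tape (replicate m True @ False # replicate j False))(Suc m := 2)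
      = bits_tape (replicate (Suc m) True @ replicate j False)"
    using bits_tape_update(1)[of "replicate m True" False "replicate j False" True]
    by (simp add: bit_symbol_def replicate_app_Cons_same)
  show ?case
    by (rule counts_focus[where s = 2 and e = Right and q' = "Borrow l"
          and bs' = "replicate (Suc m) True @ replicate j False"])
      (use read written Suc.prems Suc.IH[of "Suc m"] assms(1)
          symbols_c[of "replicate m True @ False # replicate j False" "Suc m"] in auto)
qed

private lemma at_rest_focus: "at_rest bss = focus (bss ! c) 0"
  using at_rest_update[of bss c "bss ! c"] by simp

lemma counts_Inc:
  assumes "P l = Inc c l'" "length (incr (bss ! c)) \<le> K"
    and "counts (compile P l0 k) x (K + 2) (to_nat (At l'), h, at_rest (bss[c := incr (bss ! c)])) n"
  shows "counts (compile P l0 k) x (K + 2) (to_nat (At l), h, at_rest bss) n"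
  by (subst at_rest_focus, rule counts_focus[where s = 3 and e = Right and bs' = "bss ! c" and q' = "Carry l"])
    (use assms counts_carry[of l l' "[]" "bss ! c"] symbols_c[of "bss ! c" 0]
      in \<open>auto simp: at_rest_update fun_upd_idem_iff\<close>)

lemma counts_Dec:
  assumes "P l = Dec c l1 l2" "length (bss ! c) \<le> K" "bits_val (bss ! c) \<noteq> 0"
    and "counts (compile P l0 k) x (K + 2) (to_nat (At l2), h, at_rest (bss[c := decr (bss ! c)])) n"
  shows "counts (compile P l0 k) x (K + 2) (to_nat (At l), h, at_rest bss) n"
  by (subst at_rest_focus, rule counts_focus[where s = 3 and e = Right and bs' = "bss ! c" and q' = "Borrow l"])
    (use assms counts_borrow[of l l1 l2 "[]" "bss ! c"] symbols_c[of "bss ! c" 0]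
      in \<open>auto simp: at_rest_update fun_upd_idem_iff\<close>)

lemma counts_Dec_zero:
  assumes "P l = Dec c l1 l2" "length (bss ! c) \<le> K" "bits_val (bss ! c) = 0"
    and "counts (compile P l0 k) x (K + 2) (to_nat (At l1), h, at_rest bss) n"
  shows "counts (compile P l0 k) x (K + 2) (to_nat (At l), h, at_rest bss) n"
proof -
  have z: "bss ! c = replicate (length (bss ! c)) False" using assms(3) bits_val_zero by blast
  have "counts M x (K + 2) (to_nat (At l1), h, focus (bss ! c) 0) n"
    using assms(4) by (subst (asm) at_rest_focus)
  then have IH: "counts M x (K + 2) (to_nat (Borrow l), h, focus (bss ! c) (Suc 0)) n"
    using counts_borrow_zero[OF assms(1), of 0 "length (bss ! c)" n] assms(2) z by simp
  show ?thesis
    by (subst at_rest_focus, rule counts_focus[where s = 3 and e = Right and bs' = "bss ! c" and q' = "Borrow l"])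
      (use IH assms(1) symbols_c[of "bss ! c" 0] in \<open>auto simp: fun_upd_idem_iff\<close>)
qed

end

text \<open>Correctness of the compiler. As counters are bounded by \<open>N < 2 ^ K\<close>, they have at most \<open>K\<close> digits,
  so that the heads reach at most the blank in cell \<open>K + 1\<close>.\<close>

lemma counts_program:
  fixes P :: "'l::finite \<Rightarrow> 'l cmd"
  assumes "program_counts P x N l h ns n" and N: "N < 2 ^ K"
    and "map bits_val bss = ns" "length bss = k" "\<forall>bs \<in> set bss. length bs \<le> K" "h \<le> length x + 1"
  shows "counts (compile P l0 k) x (K + 2) (to_nat (At l), h, at_rest bss) n"
  using assms(1,3-)
proof (induction arbitrary: bss rule: program_counts.induct)
  case (Read l f h ns n)
  note wp = well_placed_at_rest[OF Read.prems(2), of K]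
  show ?case
    by (rule counts_keep[OF wp, where d = Stay and q' = "At (f (input_at x h))"])
      (use Read in \<open>simp_all add: min_absorb1\<close>)
next
  case (Move l d l' h ns n)
  note wp = well_placed_at_rest[OF Move.prems(2), of K]
  show ?case
    by (rule counts_keep[OF wp, where d = d and q' = "At l'"]) (use Move in simp_all)
next
  case (Choose l l1 l2 h ns n1 n2)
  note wp = well_placed_at_rest[OF Choose.prems(2), of K]
  define us where "us = map (\<lambda>(tape, pos). tape pos) (at_rest bss)"
  have succs: "succs P l0 (At l) (input_at x h) us = {(At l1, Stay, keep us), (At l2, Stay, keep us)}"
    using Choose.hyps(1) by simp
  \<comment> \<open>As \<open>l1\<close> and \<open>l2\<close> differ, the new state tells which alternative was chosen.\<close>
  let ?f = "\<lambda>(q', d, acts). if q' = At l1 then n1 else n2"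
  have "counts (compile P l0 k) x (K + 2) (to_nat (At l), h, at_rest bss)
      (\<Sum>t \<in> succs P l0 (At l) (input_at x h) us. ?f t)"
  proof (rule counts_compile[OF wp us_def])
    fix q' d acts
    assume "(q', d, acts) \<in> succs P l0 (At l) (input_at x h) us"
    then consider "q' = At l1" "d = Stay" "acts = keep us" | "q' = At l2" "d = Stay" "acts = keep us"
      unfolding succs by blast
    then show "counts (compile P l0 k) x (K + 2) (to_nat q', min (move d h) (length x + 1),
        map2 (\<lambda>(tape, pos) (s, e). (tape(pos := s), move e pos)) (at_rest bss) acts) (?f (q', d, acts))"
      by cases (use Choose in \<open>simp_all add: us_def map2_keep min_absorb1 del: map_map\<close>)
  qed (simp only: succs, simp)
  then show ?case unfolding succs using Choose.hyps(2) by simp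
next
  case (Inc l c l' ns h n)
  then have c: "c < k" by auto
  have val: "bits_val (bss ! c) = ns ! c" using Inc.prems(1,2) c by auto
  have len: "length (incr (bss ! c)) \<le> K"
    using length_incr_le[of "bss ! c" K N] Inc.prems Inc.hyps c N val by auto
  show ?case
  proof (rule counts_Inc[where P = P and l = l, OF Inc.prems(2) c Inc.prems(4) Inc.hyps(1) len], rule Inc.IH)
    show "map bits_val (bss[c := incr (bss ! c)]) = ns[c := Suc (ns ! c)]"
      using Inc.prems(1) val by (simp add: map_update bits_val_incr)
    show "\<forall>bs\<in>set (bss[c := incr (bss ! c)]). length bs \<le> K"
      using Inc.prems(3) len set_update_subset_insert[of bss c "incr (bss ! c)"] by auto
  qed (use Inc.prems in auto)
next
  case (Dec_zero l c l1 l2 ns h n)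
  then have c: "c < k" by auto
  have val: "bits_val (bss ! c) = ns ! c" using Dec_zero.prems(1,2) c by auto
  have len: "length (bss ! c) \<le> K" using Dec_zero.prems(2,3) c by simp
  have zero: "bits_val (bss ! c) = 0" using val Dec_zero.hyps by simp
  show ?case
    by (rule counts_Dec_zero[where P = P and l = l, OF Dec_zero.prems(2) c Dec_zero.prems(4)
          Dec_zero.hyps(1) len zero]) (rule Dec_zero.IH[OF Dec_zero.prems])
next
  case (Dec l c l1 l2 ns h n)
  then have c: "c < k" by auto
  have val: "bits_val (bss ! c) = ns ! c" using Dec.prems(1,2) c by auto
  then have nz: "bits_val (bss ! c) \<noteq> 0" using Dec.hyps by simp
  have len: "length (bss ! c) \<le> K" using Dec.prems(2,3) c by simp
  show ?case
  proof (rule counts_Dec[where P = P and l = l, OF Dec.prems(2) c Dec.prems(4) Dec.hyps(1) len nz], rule Dec.IH)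
    show "map bits_val (bss[c := decr (bss ! c)]) = ns[c := ns ! c - 1]"
      using Dec.prems(1) val nz by (simp add: map_update bits_val_decr)
    show "\<forall>bs\<in>set (bss[c := decr (bss ! c)]). length bs \<le> K"
      using Dec.prems(3) len set_update_subset_insert[of bss c "decr (bss ! c)"] by auto
  qed (use Dec.prems in auto)
next
  case (Halt l b h ns)
  have "{i \<in> instructions (compile P l0 k). enabled x (to_nat (At l), h, at_rest bss) i} = {}"
    using Halt by (subst enabled_compile[OF _ _ refl]) (auto simp: at_rest_def bits_tape_le)
  moreover have "to_nat (At l) \<in> accepting (compile P l0 k) \<longleftrightarrow> b"
    using Halt.hyps by (auto simp: compile_def)
  ultimately show ?case
    using counts_halted[of "(to_nat (At l), h, at_rest bss)" "K + 2" "compile P l0 k" x]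
    by (auto simp: at_rest_def)
qed

lemma counts_initial_config:
  fixes P :: "'l::finite \<Rightarrow> 'l cmd"
  assumes "counts (compile P l0 k) x (K + 2) (to_nat (At l0), 0, at_rest (replicate k [])) n"
  shows "counts (compile P l0 k) x (K + 2) (initial_config (compile P l0 k)) n"
proof -
  let ?ws = "replicate k (\<lambda>_. 0 :: nat, 0 :: nat)"
  have init: "initial_config (compile P l0 k) = (to_nat (Init :: 'l state), 0, ?ws)"
    by (simp add: initial_config_def compile_def)
  have wp: "well_placed k (K + 2) ?ws" by (simp add: well_placed_def)
  have "(\<lambda>_. 0)(0 := 3) = bits_tape []"
    by (auto simp: fun_eq_iff bits_tape_def split: nat.split)
  then have marked: "map2 (\<lambda>(tape, pos) (s, e). (tape(pos := s), move e pos)) ?ws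
      (map (\<lambda>_. (3, Stay)) (map (\<lambda>(tape, pos). tape pos) ?ws)) = at_rest (replicate k [])"
    by (simp add: at_rest_def zip_replicate)
  show ?thesis
    unfolding init
    using counts_compile[OF wp refl, of P l0 Init x 0 "\<lambda>_. n"] assms marked
    by (simp add: min_def)
qed

lemma floorlog_bigo_ln: "(\<lambda>n. real (floorlog 2 n + 2)) \<in> O(\<lambda>n. ln (real n))"
proof (rule bigoI)
  show "eventually (\<lambda>n. norm (real (floorlog 2 n + 2)) \<le> (1 / ln 2 + 3) * norm (ln (real n))) sequentially"
    using eventually_ge_at_top[of 3]
  proof eventually_elim
    case (elim n)
    \<comment> \<open>This bound turns the constants, which add up to 3, into a multiple of \<open>ln n\<close>.\<close>
    have "1 \<le> ln (real n)"
      using elim exp_le by (subst ln_ge_iff) auto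
    moreover have "real (floorlog 2 n) \<le> log 2 (real n) + 1"
      using elim by (simp add: floorlog_def)
    ultimately show ?case
      by (simp add: log_def algebra_simps)
  qed
qed

text \<open>Counters bounded by the input length need only logarithmically many digits.\<close>

lemma sharpL_program:
  fixes P :: "'l::finite \<Rightarrow> 'l cmd"
  assumes "\<And>x. program_counts P x (length x) l0 0 (replicate k 0) (f x)"
  shows "f \<in> sharpL"
proof (rule sharpL_I[OF ntm_wf_compile floorlog_bigo_ln])
  show "counts (compile P l0 k) x (floorlog 2 (length x) + 2) (initial_config (compile P l0 k)) (f x)" for x
    by (intro counts_initial_config counts_program[OF assms])
      (auto intro: floorlog_leD)
qed

section \<open>A counter program for products of block counts\<close>

text \<open>Unfolding this equation for a concrete label executes its command.\<close>

lemma program_counts_iff: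
  "program_counts P x N l h ns n \<longleftrightarrow> (case P l of
     Read f \<Rightarrow> program_counts P x N (f (input_at x h)) h ns n
   | Move d l' \<Rightarrow> program_counts P x N l' (min (move d h) (length x + 1)) ns n
   | Choose l1 l2 \<Rightarrow> l1 \<noteq> l2 \<and>
       (\<exists>n1 n2. n = n1 + n2 \<and> program_counts P x N l1 h ns n1 \<and> program_counts P x N l2 h ns n2)
   | Inc c l' \<Rightarrow> c < length ns \<and> ns ! c < N \<and> program_counts P x N l' h (ns[c := Suc (ns ! c)]) n
   | Dec c l1 l2 \<Rightarrow> c < length ns \<and>
       (if ns ! c = 0 then program_counts P x N l1 h ns n else program_counts P x N l2 h (ns[c := ns ! c - 1]) n)
   | Halt b \<Rightarrow> n = of_bool b)" (is "?L \<longleftrightarrow> ?R")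
proof
  assume ?L
  then show ?R by cases auto
next
  assume R: ?R
  show ?L
  proof (cases "P l")
    case (Halt b)
    then show ?thesis using R program_counts.Halt[of P l b] by simp
  qed (use R in \<open>auto intro: program_counts.intros split: if_splits\<close>)
qed

text \<open>The phases of the program, where counter 0 is the depth, counter 1 the excess \<open>e\<close> and counter 2 the
  distance from the start of the block:

  \<^item> \<open>Scan\<close>: check from left to right that the input is balanced.
  \<^item> \<open>Back\<close>: go left to the next 1 and start with its block, or accept at the left end.
  \<^item> \<open>First\<close>: scan the first subtree of the block, guessing increments of the excess. The 1 at the
    start of the block is not counted in the depth, so that a 0 at depth zero ends the subtree.
  \<^item> \<open>Rest\<close>: scan the rest of the block, guessing decrements of the excess. A 0 at depth zero ends the
    block, and so does the end of the input, where the depth has to be zero as well.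
  \<^item> \<open>Settle\<close>: reject unless the excess is zero.
  \<^item> \<open>Rewind\<close>: return to the start of the block.\<close>

datatype label =
    Scan | ScanOpen | ScanClose | ScanNext | ScanEnd
  | Back | Outer
  | FirstGuess | FirstInc | FirstNext | FirstMove | FirstRead | FirstOpen | FirstClose
  | RestNext | RestMove | RestRead | RestOpen | RestGuess | RestDec | RestClose | RestEnd
  | Settle | Rewind | RewindMove
  | Accept | Reject

instance label :: finite
proof
  let ?L = "{Scan, ScanOpen, ScanClose, ScanNext, ScanEnd, Back, Outer,
    FirstGuess, FirstInc, FirstNext, FirstMove, FirstRead, FirstOpen, FirstClose,
    RestNext, RestMove, RestRead, RestOpen, RestGuess, RestDec, RestClose, RestEnd,
    Settle, Rewind, RewindMove, Accept, Reject}"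
  have "l \<in> ?L" for l by (cases l) simp_all
  then show "finite (UNIV :: label set)" by (intro finite_subset[of UNIV ?L]) auto
qed

fun program :: "label \<Rightarrow> label cmd" where
  "program Scan = Read (\<lambda>a. case a of
     Left_End \<Rightarrow> ScanNext | Bit b \<Rightarrow> if b then ScanOpen else ScanClose | Right_End \<Rightarrow> ScanEnd)"
| "program ScanOpen = Inc 0 ScanNext"
| "program ScanClose = Dec 0 Reject ScanNext"
| "program ScanNext = Move Right Scan"
| "program ScanEnd = Dec 0 Back Reject"
| "program Back = Move Left Outer"
| "program Outer = Read (\<lambda>a. case a of
     Left_End \<Rightarrow> Accept | Bit b \<Rightarrow> if b then FirstGuess else Back | Right_End \<Rightarrow> Reject)"
| "program FirstGuess = Choose FirstInc FirstNext"
| "program FirstInc = Inc 1 FirstNext"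
| "program FirstNext = Inc 2 FirstMove"
| "program FirstMove = Move Right FirstRead"
| "program FirstRead = Read (\<lambda>a. case a of
     Bit b \<Rightarrow> if b then FirstOpen else FirstClose | _ \<Rightarrow> Reject)"
| "program FirstOpen = Inc 0 FirstGuess"
| "program FirstClose = Dec 0 RestNext FirstNext"
| "program RestNext = Inc 2 RestMove"
| "program RestMove = Move Right RestRead"
| "program RestRead = Read (\<lambda>a. case a of
     Left_End \<Rightarrow> Reject | Bit b \<Rightarrow> if b then RestOpen else RestClose | Right_End \<Rightarrow> RestEnd)"
| "program RestOpen = Inc 0 RestGuess"
| "program RestGuess = Choose RestDec RestNext"
| "program RestDec = Dec 1 Reject RestNext"
| "program RestClose = Dec 0 Settle RestNext"
| "program RestEnd = Dec 0 Settle Reject"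
| "program Settle = Dec 1 Rewind Reject"
| "program Rewind = Dec 2 Back RewindMove"
| "program RewindMove = Move Left Rewind"
| "program Accept = Halt True"
| "program Reject = Halt False"

text \<open>The number of ways in which the guesses succeed, if \<open>u\<close> is still to be read and depth and excess
  are \<open>d\<close> and \<open>e\<close>, during the scan of the rest of the block and of its first subtree, respectively.\<close>

fun rest_count :: "bool list \<Rightarrow> nat \<Rightarrow> nat \<Rightarrow> nat" where
  "rest_count [] d e = of_bool (d = 0 \<and> e = 0)"
| "rest_count (True # u) d e =
     (case e of 0 \<Rightarrow> 0 | Suc e' \<Rightarrow> rest_count u (Suc d) e') + rest_count u (Suc d) e"
| "rest_count (False # u) 0 e = of_bool (e = 0)"
| "rest_count (False # u) (Suc d) e = rest_count u d e"

fun first_count :: "bool list \<Rightarrow> nat \<Rightarrow> nat \<Rightarrow> nat" where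
  "first_count [] d e = 0"
| "first_count (True # u) d e = first_count u (Suc d) (Suc e) + first_count u (Suc d) e"
| "first_count (False # u) 0 e = rest_count u 0 e"
| "first_count (False # u) (Suc d) e = first_count u d e"

text \<open>The number of successful guesses for the block that consists of a 1 and a prefix of \<open>u\<close>.\<close>

definition block_count :: "bool list \<Rightarrow> nat" where
  "block_count u = first_count u 0 1 + first_count u 0 0"

text \<open>\<open>u\<close> completes a word with \<open>d\<close> open brackets to a balanced one.\<close>

fun balanced :: "bool list \<Rightarrow> nat \<Rightarrow> bool" where
  "balanced [] d \<longleftrightarrow> d = 0"
| "balanced (True # u) d \<longleftrightarrow> balanced u (Suc d)"
| "balanced (False # u) 0 \<longleftrightarrow> False"
| "balanced (False # u) (Suc d) \<longleftrightarrow> balanced u d"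

text \<open>The product of the block counts at all ones of a word.\<close>

fun total_count :: "bool list \<Rightarrow> nat" where
  "total_count [] = 1"
| "total_count (b # u) = (if b then block_count u else 1) * total_count u"

context
  fixes x :: "bool list"
begin

private abbreviation (input) runs where "runs l h ns n \<equiv> program_counts program x (length x) l h ns n"

private lemma runs_Reject: "runs Reject h ns 0"
  by (simp add: program_counts_iff)

text \<open>Cell \<open>h\<close> carries the symbol with index \<open>h - 1\<close>, so that \<open>drop (h - 1) x\<close> is still to be read.\<close>

private lemma input_at_Cons:
  assumes "drop (h - 1) x = b # u" "0 < h"
  shows "input_at x h = Bit b" "h \<le> length x" "drop h x = u"
proof -
  have *: "h - 1 < length x" using assms(1) by (cases "h - 1 < length x") auto
  then show "h \<le> length x" by simp
  have "x ! (h - 1) = b" "drop (Suc (h - 1)) x = u"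
    using assms(1) Cons_nth_drop_Suc[OF *] by auto
  then show "input_at x h = Bit b" "drop h x = u"
    using assms(2) * by (auto simp: input_at_def)
qed

text \<open>In the following, \<open>p\<close> is the position of the 1 at which the block starts, \<open>K\<close> is the number of
  accepting computations after the block has been treated, and \<open>D\<close> is the distance already covered.
  The assumptions \<open>d \<le> D\<close> and \<open>e \<le> D\<close> below ensure that no counter exceeds the input length.\<close>

private lemma runs_Rewind:
  assumes "runs Back p [0, 0, 0] K" "p + D \<le> length x + 1"
  shows "runs Rewind (p + D) [0, 0, D] K"
  using assms(2)
proof (induction D)
  case 0
  then show ?case
    using assms(1) by (simp add: program_counts_iff[of _ _ _ Rewind])
next
  case (Suc D)
  then show ?case
    by (simp add: program_counts_iff[of _ _ _ Rewind "Suc (p + D)"] program_counts_iff[of _ _ _ RewindMove] min_absorb1)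
qed

private lemma runs_Settle:
  assumes "runs Back p [0, 0, 0] K" "p + D \<le> length x + 1"
  shows "runs Settle (p + D) [0, e, D] (of_bool (e = 0) * K)"
  using runs_Rewind[OF assms] by (auto simp: program_counts_iff[of _ _ _ Settle] runs_Reject)

private lemma runs_RestNext:
  "h \<le> length x \<Longrightarrow> D < length x \<Longrightarrow> runs RestRead (Suc h) [d, e, Suc D] n \<Longrightarrow> runs RestNext h [d, e, D] n"
  by (simp add: program_counts_iff[of _ _ _ RestNext] program_counts_iff[of _ _ _ RestMove])

private lemma runs_RestRead:
  assumes K: "runs Back p [0, 0, 0] K" and p: "0 < p"
    and "p + D \<le> length x + 1" "d \<le> D" "drop (p + D - 1) x = u"
  shows "runs RestRead (p + D) [d, e, D] (rest_count u d e * K)"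
  using assms(3-)
proof (induction u d e arbitrary: D rule: rest_count.induct)
  case (1 d e)
  have "input_at x (p + D) = Right_End"
    using 1 p by (auto simp: input_at_def)
  then show ?case
    using runs_Settle[OF K 1(1), of e]
    by (auto simp: program_counts_iff[of _ _ _ RestRead] program_counts_iff[of _ _ _ RestEnd] runs_Reject)
next
  case (2 u d e)
  have p': "0 < p + D" using p by simp
  note u = input_at_Cons[OF 2(5) p']
  have D: "D < length x" using p u(2) by linarith
  have IH: "runs RestNext (p + D) [Suc d, e', D] (rest_count u (Suc d) e' * K)"
    if "e' = e \<or> e = Suc e'" for e'
    using that runs_RestNext[OF u(2) D] 2(1)[of e' "Suc D"] 2(2)[of "Suc D"] 2(3,4) u
    by auto
  have dec: "runs RestDec (p + D) [Suc d, e, D]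
      ((case e of 0 \<Rightarrow> 0 | Suc e' \<Rightarrow> rest_count u (Suc d) e') * K)"
    using IH by (auto simp: program_counts_iff[of _ _ _ RestDec] runs_Reject split: nat.split)
  have "runs RestGuess (p + D) [Suc d, e, D] (rest_count (True # u) d e * K)"
    unfolding rest_count.simps add_mult_distrib
    by (rule program_counts.Choose[where l = RestGuess and ?l1.0 = RestDec and ?l2.0 = RestNext])
      (use dec IH in simp_all)
  then show ?case
    using u D 2(4) by (simp add: program_counts_iff[of _ _ _ RestRead] program_counts_iff[of _ _ _ RestOpen])
next
  case (3 u e)
  have p': "0 < p + D" using p by simp
  note u = input_at_Cons[OF 3(3) p']
  show ?case
    using runs_Settle[OF K 3(1), of e] u
    by (simp add: program_counts_iff[of _ _ _ RestRead] program_counts_iff[of _ _ _ RestClose])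
next
  case (4 u d e)
  have p': "0 < p + D" using p by simp
  note u = input_at_Cons[OF 4(4) p']
  have D: "D < length x" using p u(2) by linarith
  have "runs RestNext (p + D) [d, e, D] (rest_count u d e * K)"
    using runs_RestNext[OF u(2) D] 4(1)[of "Suc D"] 4(3) u by simp
  then show ?case
    using u by (simp add: program_counts_iff[of _ _ _ RestRead] program_counts_iff[of _ _ _ RestClose])
qed

private lemma runs_FirstNext:
  "h \<le> length x \<Longrightarrow> D < length x \<Longrightarrow> runs FirstRead (Suc h) [d, e, Suc D] n \<Longrightarrow> runs FirstNext h [d, e, D] n"
  by (simp add: program_counts_iff[of _ _ _ FirstNext] program_counts_iff[of _ _ _ FirstMove])

private lemma runs_FirstGuess:
  assumes "e < length x" "runs FirstNext h [d, Suc e, D] n1" "runs FirstNext h [d, e, D] n2"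
  shows "runs FirstGuess h [d, e, D] (n1 + n2)"
  by (rule program_counts.Choose[where l = FirstGuess and ?l1.0 = FirstInc and ?l2.0 = FirstNext])
    (use assms in \<open>simp_all add: program_counts_iff[of _ _ _ FirstInc]\<close>)

private lemma runs_FirstRead:
  assumes K: "runs Back p [0, 0, 0] K" and p: "0 < p"
    and "p + D \<le> length x + 1" "d \<le> D" "e \<le> D" "drop (p + D - 1) x = u"
  shows "runs FirstRead (p + D) [d, e, D] (first_count u d e * K)"
  using assms(3-)
proof (induction u d e arbitrary: D rule: first_count.induct)
  case (1 d e)
  have "input_at x (p + D) = Right_End"
    using 1 p by (auto simp: input_at_def)
  then show ?case
    by (simp add: program_counts_iff[of _ _ _ FirstRead] runs_Reject)
next
  case (2 u d e)
  have p': "0 < p + D" using p by simp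
  note u = input_at_Cons[OF 2(6) p']
  have D: "D < length x" using p u(2) by linarith
  have IH: "runs FirstNext (p + D) [Suc d, e', D] (first_count u (Suc d) e' * K)"
    if "e' = e \<or> e' = Suc e" for e'
    using that runs_FirstNext[OF u(2) D] 2(1)[of "Suc D"] 2(2)[of "Suc D"] 2(4,5) u
    by auto
  have "runs FirstGuess (p + D) [Suc d, e, D] (first_count (True # u) d e * K)"
    unfolding first_count.simps add_mult_distrib
    using IH 2(5) D by (intro runs_FirstGuess) auto
  then show ?case
    using u D 2(4) by (simp add: program_counts_iff[of _ _ _ FirstRead] program_counts_iff[of _ _ _ FirstOpen])
next
  case (3 u e)
  have p': "0 < p + D" using p by simp
  note u = input_at_Cons[OF 3(4) p']
  have D: "D < length x" using p u(2) by linarith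
  have "runs RestNext (p + D) [0, e, D] (rest_count u 0 e * K)"
    using runs_RestNext[OF u(2) D] runs_RestRead[OF K p, of "Suc D" 0 u e] u by simp
  then show ?case
    using u by (simp add: program_counts_iff[of _ _ _ FirstRead] program_counts_iff[of _ _ _ FirstClose])
next
  case (4 u d e)
  have p': "0 < p + D" using p by simp
  note u = input_at_Cons[OF 4(5) p']
  have D: "D < length x" using p u(2) by linarith
  have "runs FirstNext (p + D) [d, e, D] (first_count u d e * K)"
    using runs_FirstNext[OF u(2) D] 4(1)[of "Suc D"] 4(3,4) u by simp
  then show ?case
    using u by (simp add: program_counts_iff[of _ _ _ FirstRead] program_counts_iff[of _ _ _ FirstClose])
qed

text \<open>Blocks are treated from right to left, so only the ones to the left of the head remain to
  contribute a factor.\<close>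

private lemma runs_Back:
  assumes "i \<le> length x"
  shows "runs Back (Suc i) [0, 0, 0] (\<Prod>j<i. if x ! j then block_count (drop (Suc j) x) else 1)"
  using assms
proof (induction i)
  case 0
  have "input_at x 0 = Left_End" by (simp add: input_at_def)
  then show ?case
    by (simp add: program_counts_iff[of _ _ _ Back] program_counts_iff[of _ _ _ Outer] program_counts_iff[of _ _ _ Accept])
next
  case (Suc i)
  let ?K = "\<Prod>j<i. if x ! j then block_count (drop (Suc j) x) else 1"
  have i: "input_at x (Suc i) = Bit (x ! i)" "Suc i \<le> length x"
    using Suc.prems by (auto simp: input_at_def)
  have IH: "runs Back (Suc i) [0, 0, 0] ?K" using Suc by simp
  have "0 < length x" using i(2) by linarith
  then have "runs FirstNext (Suc i) [0, e, 0] (first_count (drop (Suc i) x) 0 e * ?K)" if "e \<le> 1" for e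
    using runs_FirstNext[OF i(2), of 0 0 e] runs_FirstRead[OF IH, of 1 0 e] that Suc.prems by simp
  from runs_FirstGuess[OF _ this this, of 0] this
  have "runs FirstGuess (Suc i) [0, 0, 0] (block_count (drop (Suc i) x) * ?K)"
    using Suc.prems by (auto simp: block_count_def add_mult_distrib intro: runs_FirstGuess)
  then have "runs Outer (Suc i) [0, 0, 0]
      (\<Prod>j<Suc i. if x ! j then block_count (drop (Suc j) x) else 1)"
    using IH i by (auto simp: program_counts_iff[of _ _ _ Outer] mult.commute)
  then show ?case
    using Suc.prems by (simp add: program_counts_iff[of _ _ _ Back "Suc (Suc i)"] min_absorb1 del: prod.lessThan_Suc)
qed

private lemma runs_Scan:
  assumes K: "runs Back (length x + 1) [0, 0, 0] K"
    and "0 < h" "h \<le> length x + 1" "d < h" "drop (h - 1) x = u"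
  shows "runs Scan h [d, 0, 0] (of_bool (balanced u d) * K)"
  using assms(2-)
proof (induction u d arbitrary: h rule: balanced.induct)
  case (1 d)
  then have "h = length x + 1" "input_at x h = Right_End"
    by (auto simp: input_at_def)
  then show ?case
    using K by (simp add: program_counts_iff[of _ _ _ Scan] program_counts_iff[of _ _ _ ScanEnd] runs_Reject)
next
  case (2 u d)
  note u = input_at_Cons[OF 2(5,2)]
  show ?case
    using u 2(1)[of "Suc h"] 2(2,4)
    by (simp add: program_counts_iff[of _ _ _ Scan h] program_counts_iff[of _ _ _ ScanOpen] program_counts_iff[of _ _ _ ScanNext])
next
  case (3 u)
  note u = input_at_Cons[OF 3(4,1)]
  show ?case
    using u by (simp add: program_counts_iff[of _ _ _ Scan] program_counts_iff[of _ _ _ ScanClose] runs_Reject)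
next
  case (4 u d)
  note u = input_at_Cons[OF 4(5,2)]
  show ?case
    using u 4(1)[of "Suc h"] 4(2,4)
    by (simp add: program_counts_iff[of _ _ _ Scan h] program_counts_iff[of _ _ _ ScanClose] program_counts_iff[of _ _ _ ScanNext])
qed

private lemma total_count_eq_prod:
  "total_count u = (\<Prod>j<length u. if u ! j then block_count (drop (Suc j) u) else 1)"
  by (induction u) (simp_all add: prod.lessThan_Suc_shift del: prod.lessThan_Suc cong: if_cong)

lemma program_counts_program:
  "program_counts program x (length x) Scan 0 (replicate 3 0) (of_bool (balanced x 0) * total_count x)"
proof -
  have "runs Scan 1 [0, 0, 0] (of_bool (balanced x 0) * total_count x)"
    using runs_Scan[of "total_count x" 1 0 x] runs_Back[of "length x"]
    by (simp add: total_count_eq_prod)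
  moreover have "input_at x 0 = Left_End" by (simp add: input_at_def)
  ultimately show ?thesis
    by (simp add: program_counts_iff[of _ _ _ Scan 0] program_counts_iff[of _ _ _ ScanNext] numeral_3_eq_3)
qed

end

section \<open>Balanced words\<close>

lemma balanced_dfs: "balanced (dfs t @ v) d \<longleftrightarrow> balanced v d"
proof (induction t arbitrary: v d rule: dfs.induct)
  case (1 ts)
  then show ?case by (induction ts) auto
qed

text \<open>A word that closes \<open>d\<close> open brackets starts with the traversal of a tree, followed by a closing
  bracket unless \<open>d = 0\<close>.\<close>

lemma balanced_split:
  assumes "balanced x d"
  shows "\<exists>t v. x = dfs t @ v \<and>
    (case d of 0 \<Rightarrow> v = [] | Suc d' \<Rightarrow> \<exists>v'. v = False # v' \<and> balanced v' d')"
  using assms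
proof (induction "length x" arbitrary: x d rule: less_induct)
  case less
  show ?case
  proof (cases x)
    case Nil
    then show ?thesis using less.prems by (intro exI[of _ "Node []"]) simp
  next
    case (Cons b u)
    show ?thesis
    proof (cases b)
      case False
      then show ?thesis
        using less.prems Cons by (intro exI[of _ "Node []"]) (cases d; simp)
    next
      case True
      then have "balanced u (Suc d)" using less.prems Cons by simp
      then obtain t v where u: "u = dfs t @ False # v" "balanced v d"
        using less.hyps[of u "Suc d"] Cons by auto
      then obtain t' w where v: "v = dfs t' @ w"
        "case d of 0 \<Rightarrow> w = [] | Suc d' \<Rightarrow> \<exists>v'. w = False # v' \<and> balanced v' d'"
        using less.hyps[of v d] Cons by auto
      obtain ts where "t' = Node ts" by (cases t')
      then have "x = dfs (Node (t # ts)) @ w" using Cons True u v by simp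
      then show ?thesis using v(2) by blast
    qed
  qed
qed

lemma balanced_iff: "balanced x 0 \<longleftrightarrow> x \<in> range dfs"
proof
  assume "balanced x 0"
  then show "x \<in> range dfs" using balanced_split[of x 0] by auto
next
  assume "x \<in> range dfs"
  then show "balanced x 0" using balanced_dfs[of _ "[]" 0] by auto
qed

section \<open>Linear extensions as enumerations\<close>

text \<open>The linear extensions of a relation \<open>R\<close> on \<open>V\<close>, written as the lists of the elements of \<open>V\<close> in
  increasing order of their labels.\<close>

definition enumerations :: "'a set \<Rightarrow> ('a \<Rightarrow> 'a \<Rightarrow> bool) \<Rightarrow> 'a list set" where
  "enumerations V R = {xs. distinct xs \<and> set xs = V \<and> sorted_wrt (\<lambda>a b. \<not> R b a) xs}"

lemma finite_enumerations: "finite V \<Longrightarrow> finite (enumerations V R)"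
  by (rule finite_subset[OF _ finite_subset_distinct[of V]]) (auto simp: enumerations_def)

lemma length_enumeration: "xs \<in> enumerations V R \<Longrightarrow> length xs = card V"
  by (auto simp: enumerations_def distinct_card)

lemma card_enumerations_image:
  assumes inj: "inj_on f V" and R: "\<And>a b. a \<in> V \<Longrightarrow> b \<in> V \<Longrightarrow> R' (f a) (f b) \<longleftrightarrow> R a b"
  shows "card (enumerations (f ` V) R') = card (enumerations V R)"
proof -
  have sorted: "sorted_wrt (\<lambda>a b. \<not> R' b a) (map f xs) \<longleftrightarrow> sorted_wrt (\<lambda>a b. \<not> R b a) xs"
    if "set xs = V" for xs
    unfolding sorted_wrt_map using that R by (auto simp: sorted_wrt_iff_nth_less)
  have "enumerations (f ` V) R' = map f ` enumerations V R"
  proof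
    show "map f ` enumerations V R \<subseteq> enumerations (f ` V) R'"
      using inj sorted by (auto simp: enumerations_def distinct_map)
    show "enumerations (f ` V) R' \<subseteq> map f ` enumerations V R"
    proof
      fix ys assume ys: "ys \<in> enumerations (f ` V) R'"
      define xs where "xs = map (inv_into V f) ys"
      have "set xs = V"
        using ys inj by (auto simp: enumerations_def xs_def inv_into_into)
      moreover have "map f xs = ys"
        using ys by (auto simp: enumerations_def xs_def f_inv_into_f intro!: map_idI)
      ultimately have "xs \<in> enumerations V R"
        using ys sorted[of xs] by (auto simp: enumerations_def distinct_map)
      then show "ys \<in> map f ` enumerations V R" using \<open>map f xs = ys\<close> by blast
    qed
  qed
  moreover have "inj_on (map f) (enumerations V R)"
    using inj by (intro inj_on_mapI) (auto simp: enumerations_def inj_on_def)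
  ultimately show ?thesis by (simp add: card_image)
qed

lemma card_enumerations_insert_least:
  assumes "r \<notin> V" "\<And>v. v \<in> V \<Longrightarrow> R r v \<and> \<not> R v r"
  shows "card (enumerations (insert r V) R) = card (enumerations V R)"
proof -
  have "xs \<in> enumerations (insert r V) R \<longleftrightarrow> (\<exists>ys\<in>enumerations V R. xs = r # ys)" for xs
  proof (cases xs)
    case Nil
    then show ?thesis by (auto simp: enumerations_def)
  next
    case (Cons y ys)
    show ?thesis
    proof (cases "y = r")
      case True
      then show ?thesis using assms Cons by (auto simp: enumerations_def insert_ident)
    next
      case False
      have "xs \<notin> enumerations (insert r V) R"
      proof
        assume "xs \<in> enumerations (insert r V) R"
        then have eq: "insert y (set ys) = insert r V" and "\<forall>v\<in>set ys. \<not> R v y"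
          using Cons by (simp_all add: enumerations_def)
        moreover have "r \<in> set ys" "y \<in> V" using eq False by auto
        ultimately show False using assms(2) by blast
      qed
      then show ?thesis using False Cons by auto
    qed
  qed
  then have "enumerations (insert r V) R = (#) r ` enumerations V R" by auto
  then show ?thesis by (simp add: card_image)
qed

lemma sorted_wrt_shuffles:
  assumes "zs \<in> shuffles xs ys" "\<And>a b. a \<in> set xs \<Longrightarrow> b \<in> set ys \<Longrightarrow> Q a b \<and> Q b a"
  shows "sorted_wrt Q zs \<longleftrightarrow> sorted_wrt Q xs \<and> sorted_wrt Q ys"
  using assms
proof (induction xs ys arbitrary: zs rule: shuffles.induct)
  case (3 x xs y ys)
  then consider zs' where "zs = x # zs'" "zs' \<in> shuffles xs (y # ys)"
    | zs' where "zs = y # zs'" "zs' \<in> shuffles (x # xs) ys"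
    by auto
  then show ?case
  proof cases
    case 1
    then show ?thesis using 3(1)[OF 1(2)] 3(4) set_shuffles[OF 1(2)] by auto
  next
    case 2
    then show ?thesis using 3(2)[OF 2(2)] 3(4) set_shuffles[OF 2(2)] by auto
  qed
qed auto

text \<open>For incomparable parts, the enumerations of the union are the shuffles of enumerations of the
  parts.\<close>

lemma card_enumerations_Un:
  assumes fin: "finite V" "finite W" and disj: "V \<inter> W = {}"
    and R: "\<And>a b. a \<in> V \<Longrightarrow> b \<in> W \<Longrightarrow> \<not> R a b \<and> \<not> R b a"
  shows "card (enumerations (V \<union> W) R) =
    (card V + card W choose card V) * (card (enumerations V R) * card (enumerations W R))"
proof -
  let ?EV = "enumerations V R" and ?EW = "enumerations W R"
  have split: "filter (\<lambda>a. a \<in> V) zs = xs \<and> filter (\<lambda>a. a \<notin> V) zs = ys"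
    if "xs \<in> ?EV" "ys \<in> ?EW" "zs \<in> shuffles xs ys" for xs ys zs
    using that disj filter_shuffles_disjoint1[of xs ys zs] filter_shuffles_disjoint2[of xs ys zs]
    by (simp add: enumerations_def)
  have "enumerations (V \<union> W) R = (\<Union>(xs, ys) \<in> ?EV \<times> ?EW. shuffles xs ys)"
  proof
    show "(\<Union>(xs, ys) \<in> ?EV \<times> ?EW. shuffles xs ys) \<subseteq> enumerations (V \<union> W) R"
    proof clarify
      fix xs ys zs assume *: "xs \<in> ?EV" "ys \<in> ?EW" "zs \<in> shuffles xs ys"
      then have "sorted_wrt (\<lambda>a b. \<not> R b a) zs"
        using sorted_wrt_shuffles[OF *(3), of "\<lambda>a b. \<not> R b a"] R by (auto simp: enumerations_def)
      then show "zs \<in> enumerations (V \<union> W) R"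
        using * disj set_shuffles[OF *(3)] distinct_disjoint_shuffles[of xs ys zs]
        by (auto simp: enumerations_def)
    qed
    show "enumerations (V \<union> W) R \<subseteq> (\<Union>(xs, ys) \<in> ?EV \<times> ?EW. shuffles xs ys)"
    proof
      fix zs assume zs: "zs \<in> enumerations (V \<union> W) R"
      let ?xs = "filter (\<lambda>a. a \<in> V) zs" and ?ys = "filter (\<lambda>a. a \<notin> V) zs"
      have "?xs \<in> ?EV" "?ys \<in> ?EW"
        using zs disj by (auto simp: enumerations_def intro: sorted_wrt_filter)
      moreover have "zs \<in> shuffles ?xs ?ys" by (rule partition_in_shuffles)
      ultimately show "zs \<in> (\<Union>(xs, ys) \<in> ?EV \<times> ?EW. shuffles xs ys)" by blast
    qed
  qed
  also have "card \<dots> = (\<Sum>(xs, ys) \<in> ?EV \<times> ?EW. card (shuffles xs ys))"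
    unfolding split_beta
  proof (rule card_UN_disjoint)
    show "\<forall>p\<in>?EV \<times> ?EW. \<forall>q\<in>?EV \<times> ?EW. p \<noteq> q \<longrightarrow>
        shuffles (fst p) (snd p) \<inter> shuffles (fst q) (snd q) = {}"
    proof (intro ballI impI)
      fix p q assume pq: "p \<in> ?EV \<times> ?EW" "q \<in> ?EV \<times> ?EW" "p \<noteq> q"
      have "p = q" if "zs \<in> shuffles (fst p) (snd p)" "zs \<in> shuffles (fst q) (snd q)" for zs
        using split[OF _ _ that(1)] split[OF _ _ that(2)] pq by (auto simp: prod_eq_iff)
      then show "shuffles (fst p) (snd p) \<inter> shuffles (fst q) (snd q) = {}" using pq(3) by blast
    qed
  qed (simp_all add: finite_enumerations fin)
  also have "\<dots> = (\<Sum>(xs, ys) \<in> ?EV \<times> ?EW. card V + card W choose card V)"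
  proof (intro sum.cong refl, clarify)
    fix xs ys assume *: "xs \<in> ?EV" "ys \<in> ?EW"
    then have "set xs \<inter> set ys = {}" using disj by (simp add: enumerations_def)
    then show "card (shuffles xs ys) = (card V + card W choose card V)"
      using * by (simp add: card_disjoint_shuffles length_enumeration)
  qed
  finally show ?thesis by (simp add: card_cartesian_product)
qed

lemma prefix_mono_labelling:
  assumes closed: "\<And>p q. p @ q \<in> V \<Longrightarrow> p \<in> V"
    and mono: "\<And>p i. p \<in> V \<Longrightarrow> p @ [i] \<in> V \<Longrightarrow> l p < (l (p @ [i]) :: nat)"
    and "p @ q \<in> V" "q \<noteq> []"
  shows "l p < l (p @ q)"
  using assms(3,4)
proof (induction q rule: rev_induct)
  case (snoc i q)
  then have "p @ q \<in> V" using closed[of "p @ q" "[i]"] by simp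
  then have "l (p @ q) < l (p @ q @ [i])" using mono[of "p @ q" i] snoc.prems by simp
  then show ?case using snoc.IH \<open>p @ q \<in> V\<close> by (cases "q = []") auto
qed simp

lemma nodes_prefix_closed: "p @ q \<in> nodes t \<Longrightarrow> p \<in> nodes t"
proof (induction p arbitrary: t)
  case Nil
  then show ?case by (cases t) simp
next
  case (Cons i p)
  then show ?case by (cases t) auto
qed

lemma finite_nodes [simp]: "finite (nodes t)"
  by (induction t rule: nodes.induct) simp

text \<open>A labelling corresponds to the list of the nodes with labels \<open>1, \<dots>, n\<close>.\<close>

lemma num_linear_extensions_eq:
  "num_linear_extensions t = card (enumerations (nodes t) strict_prefix)"
proof -
  define V where "V = nodes t"
  define n where "n = card V"
  let ?F = "\<lambda>l. map (inv_into V l) [1..<Suc n]"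
  have L: "linear_extensions t = {l \<in> extensional V. bij_betw l V {1..n} \<and>
      (\<forall>p q. p \<in> V \<longrightarrow> q \<in> V \<longrightarrow> strict_prefix p q \<longrightarrow> l p < l q)}"
  proof -
    have "(\<forall>p i. p \<in> V \<and> p @ [i] \<in> V \<longrightarrow> l p < l (p @ [i])) \<longleftrightarrow>
        (\<forall>p q. p \<in> V \<longrightarrow> q \<in> V \<longrightarrow> strict_prefix p q \<longrightarrow> l p < l q)" for l :: "nat list \<Rightarrow> nat"
      using prefix_mono_labelling[of V l] nodes_prefix_closed[of _ _ t]
      unfolding V_def strict_prefix_def prefix_def by fastforce
    then show ?thesis unfolding linear_extensions_def V_def n_def by auto
  qed
  have inv: "l (inv_into V l k) = k" "inv_into V l k \<in> V" if "bij_betw l V {1..n}" "k \<in> {1..n}" for l k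
    using that by (auto simp: bij_betw_def f_inv_into_f inv_into_into)
  have "bij_betw ?F (linear_extensions t) (enumerations V strict_prefix)"
  proof (rule bij_betw_imageI)
    show "inj_on ?F (linear_extensions t)"
    proof (rule inj_onI)
      fix l l' assume l: "l \<in> linear_extensions t" "l' \<in> linear_extensions t" and "?F l = ?F l'"
      then have eq: "inv_into V l k = inv_into V l' k" if "k \<in> {1..n}" for k
        using that by (auto simp del: upt_Suc)
      show "l = l'"
      proof (rule extensionalityI[of _ V])
        fix v assume v: "v \<in> V"
        have k: "l v \<in> {1..n}" using l v unfolding L by (auto dest: bij_betwE)
        have "v = inv_into V l (l v)" using l v unfolding L by (auto simp: bij_betw_def inv_into_f_f)
        then show "l v = l' v" using eq[OF k] inv(1)[OF _ k, of l'] l unfolding L by auto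
      qed (use l in \<open>auto simp: L\<close>)
    qed
    show "?F ` linear_extensions t = enumerations V strict_prefix"
    proof
      show "?F ` linear_extensions t \<subseteq> enumerations V strict_prefix"
      proof clarify
        fix l assume l: "l \<in> linear_extensions t"
        then have bij: "bij_betw l V {1..n}" by (simp add: L)
        have "bij_betw (inv_into V l) {1..n} V" by (rule bij_betw_inv_into[OF bij])
        then have "distinct (?F l)" "set (?F l) = V"
          by (auto simp: distinct_map bij_betw_def atLeastLessThanSuc_atLeastAtMost simp del: upt_Suc)
        moreover have "sorted_wrt (\<lambda>a b. \<not> strict_prefix b a) (?F l)"
          unfolding sorted_wrt_map
        proof (rule sorted_wrt_mono_rel[OF _ sorted_wrt_upt])
          fix j k assume jk: "j \<in> set [1..<Suc n]" "k \<in> set [1..<Suc n]" "j < k"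
          then have "j \<in> {1..n}" "k \<in> {1..n}" by auto
          then show "\<not> strict_prefix (inv_into V l k) (inv_into V l j)"
            using l inv[OF bij] jk(3) unfolding L by (metis (mono_tags, lifting) mem_Collect_eq not_less_iff_gr_or_eq)
        qed
        ultimately show "?F l \<in> enumerations V strict_prefix" by (simp add: enumerations_def)
      qed
      show "enumerations V strict_prefix \<subseteq> ?F ` linear_extensions t"
      proof
        fix xs assume xs: "xs \<in> enumerations V strict_prefix"
        then have len: "length xs = n" by (simp add: length_enumeration n_def)
        define pos where "pos = inv_into {..<n} ((!) xs)"
        define l where "l = restrict (\<lambda>v. Suc (pos v)) V"
        have nth: "bij_betw ((!) xs) {..<n} V"
          using xs len by (auto simp: enumerations_def intro!: bij_betw_nth)
        have pos: "pos v < n" "xs ! pos v = v" if "v \<in> V" for v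
          using nth that by (auto simp: pos_def bij_betw_def f_inv_into_f dest: inv_into_into[of v "(!) xs" "{..<n}"])
        have pos_nth: "pos (xs ! k) = k" if "k < n" for k
          using nth that by (auto simp: pos_def bij_betw_def inv_into_f_f)
        have "bij_betw pos V {..<n}" unfolding pos_def by (rule bij_betw_inv_into[OF nth])
        then have "bij_betw (Suc \<circ> pos) V {1..n}"
          by (rule bij_betw_trans) (auto simp: bij_betw_def image_Suc_lessThan)
        then have bij: "bij_betw l V {1..n}"
          by (rule bij_betw_cong[THEN iffD1, rotated]) (simp add: l_def)
        have "l p < l q" if "p \<in> V" "q \<in> V" "strict_prefix p q" for p q
        proof -
          have "\<not> pos q < pos p"
            using xs that pos[of p] pos[of q] len
            unfolding enumerations_def sorted_wrt_iff_nth_less by (metis (no_types, lifting) mem_Collect_eq)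
          moreover have "pos p \<noteq> pos q" using that pos(2) by (metis strict_prefix_def)
          ultimately show ?thesis using that by (simp add: l_def)
        qed
        then have "l \<in> linear_extensions t" using bij by (simp add: L l_def)
        moreover have "?F l = xs"
        proof (rule nth_equalityI)
          fix k assume "k < length (?F l)"
          then have k: "k < n" by (simp del: upt_Suc)
          have "xs ! k \<in> V" using nth k by (auto dest: bij_betwE)
          moreover have "l (xs ! k) = Suc k" using calculation pos_nth[OF k] by (simp add: l_def)
          ultimately have "inv_into V l (Suc k) = xs ! k"
            using bij by (metis bij_betw_inv_into_left)
          then show "?F l ! k = xs ! k" using k by (simp del: upt_Suc)
        qed (simp add: len)
        ultimately show "xs \<in> ?F ` linear_extensions t" by (metis image_eqI)
      qed
    qed
  qed
  then show ?thesis unfolding num_linear_extensions_def V_def by (rule bij_betw_same_card)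
qed

section \<open>Recursion for the number of linear extensions\<close>

text \<open>Removing the first child of the root makes structural induction on plane trees a binary
  recursion.\<close>

lemma ptree_induct [case_names Leaf Cons]:
  assumes "P (Node [])" "\<And>t ts. P t \<Longrightarrow> P (Node ts) \<Longrightarrow> P (Node (t # ts))"
  shows "P t"
proof (induction t rule: dfs.induct)
  case (1 ts)
  then show ?case by (induction ts) (use assms in auto)
qed

text \<open>The address in \<open>Node (t # ts)\<close> of a node given by its address in \<open>Node ts\<close>.\<close>

fun shift_address :: "nat list \<Rightarrow> nat list" where
  "shift_address [] = []"
| "shift_address (i # p) = Suc i # p"

lemma nodes_Cons:
  "nodes (Node (t # ts)) = insert [] ((#) 0 ` nodes t \<union> shift_address ` (nodes (Node ts) - {[]}))"
proof -
  have "(\<Union>i<length (t # ts). (#) i ` nodes ((t # ts) ! i))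
      = (#) 0 ` nodes t \<union> shift_address ` (\<Union>i<length ts. (#) i ` nodes (ts ! i))"
    by (simp add: lessThan_Suc_eq_insert_0 image_Un image_UN image_image)
  moreover have "nodes (Node ts) - {[]} = (\<Union>i<length ts. (#) i ` nodes (ts ! i))"
    by auto
  ultimately show ?thesis by (simp only: nodes.simps(1)[of "t # ts"])
qed

lemma shift_address_eq_Nil [simp]: "shift_address p = [] \<longleftrightarrow> p = []" "[] = shift_address p \<longleftrightarrow> p = []"
  by (cases p; simp)+

lemma shift_address_eq_Cons_0 [simp]: "shift_address q \<noteq> 0 # p" "0 # p \<noteq> shift_address q"
  by (cases q; simp)+

text \<open>The number of edges, that is, of nodes other than the root.\<close>

fun edges :: "ptree \<Rightarrow> nat" where
  "edges (Node ts) = (\<Sum>t\<leftarrow>ts. Suc (edges t))"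

lemma inj_on_shift_address: "inj_on shift_address A"
proof (rule inj_onI)
  fix p q assume "shift_address p = shift_address q"
  then show "p = q" by (cases p; cases q) auto
qed

lemma Nil_in_nodes [simp]: "[] \<in> nodes t"
  by (cases t) simp

lemma disjoint_children:
  "(#) 0 ` nodes t \<inter> shift_address ` (nodes (Node ts) - {[]}) = {}"
  by auto

lemma card_nodes: "card (nodes t) = Suc (edges t)"
proof (induction t rule: ptree_induct)
  case (Cons t ts)
  have "card (nodes (Node (t # ts)))
      = Suc (card (nodes t) + card (nodes (Node ts) - {[]}))"
    unfolding nodes_Cons
    by (subst card_insert_disjoint)
      (auto simp: card_Un_disjoint[OF _ _ disjoint_children] card_image inj_on_shift_address
        simp del: nodes.simps)
  then show ?case using Cons.IH by (simp add: card_Diff_singleton del: nodes.simps)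
qed simp

lemma num_linear_extensions_forest:
  "num_linear_extensions (Node ts) = card (enumerations (nodes (Node ts) - {[]}) strict_prefix)"
proof -
  have "nodes (Node ts) = insert [] (nodes (Node ts) - {[]})" by auto
  then have "num_linear_extensions (Node ts)
      = card (enumerations (insert [] (nodes (Node ts) - {[]})) strict_prefix)"
    unfolding num_linear_extensions_eq by (rule arg_cong)
  also have "\<dots> = card (enumerations (nodes (Node ts) - {[]}) strict_prefix)"
    by (rule card_enumerations_insert_least) (auto simp: strict_prefix_def)
  finally show ?thesis .
qed

lemma num_linear_extensions_Nil: "num_linear_extensions (Node []) = 1"
proof -
  have "enumerations {} R = {[]}" for R :: "nat list \<Rightarrow> nat list \<Rightarrow> bool"
    by (auto simp: enumerations_def)
  then show ?thesis by (simp add: num_linear_extensions_forest)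
qed

lemma num_linear_extensions_Cons:
  "num_linear_extensions (Node (t # ts)) =
    (Suc (edges t) + edges (Node ts) choose Suc (edges t)) *
      (num_linear_extensions t * num_linear_extensions (Node ts))"
proof -
  let ?V = "(#) 0 ` nodes t" and ?W = "shift_address ` (nodes (Node ts) - {[]})"
  have "nodes (Node (t # ts)) - {[]} = ?V \<union> ?W"
    unfolding nodes_Cons by (auto simp del: nodes.simps)
  then have "num_linear_extensions (Node (t # ts)) = card (enumerations (?V \<union> ?W) strict_prefix)"
    by (simp only: num_linear_extensions_forest)
  also have "\<dots> = (card ?V + card ?W choose card ?V) *
      (card (enumerations ?V strict_prefix) * card (enumerations ?W strict_prefix))"
  proof (rule card_enumerations_Un)
    fix a b assume "a \<in> ?V" "b \<in> ?W"
    then obtain p i q where "a = 0 # p" "b = Suc i # q"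
      by (metis (no_types, lifting) Diff_iff image_iff insertI1 shift_address.elims)
    then show "\<not> strict_prefix a b \<and> \<not> strict_prefix b a" by simp
  qed (simp_all add: disjoint_children del: nodes.simps)
  also have "card (enumerations ?V strict_prefix) = num_linear_extensions t"
    unfolding num_linear_extensions_eq by (rule card_enumerations_image) auto
  also have "card (enumerations ?W strict_prefix) = num_linear_extensions (Node ts)"
    unfolding num_linear_extensions_forest
  proof (rule card_enumerations_image[OF inj_on_shift_address])
    fix p q assume "p \<in> nodes (Node ts) - {[]}" "q \<in> nodes (Node ts) - {[]}"
    then show "strict_prefix (shift_address p) (shift_address q) \<longleftrightarrow> strict_prefix p q"
      by (cases p; cases q) auto
  qed
  also have "card ?V = Suc (edges t)" by (simp add: card_image card_nodes)
  also have "card ?W = edges (Node ts)"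
    by (simp add: card_image inj_on_shift_address card_nodes card_Diff_singleton del: nodes.simps)
  finally show ?thesis .
qed

section \<open>Block counts are binomial coefficients\<close>

lemma edges_simps: "edges (Node []) = 0" "edges (Node (t # ts)) = Suc (edges t) + edges (Node ts)"
  by simp_all

lemma dfs_Cons: "dfs (Node (t # ts)) @ v = True # dfs t @ False # dfs (Node ts) @ v"
  by simp

text \<open>This lemma and the next propagate a binomial coefficient backwards over the traversal of a tree,
  with one application of Pascal's rule for each 1.\<close>

lemma rest_count_dfs:
  assumes "\<And>e. rest_count v d e = (M choose e)"
  shows "rest_count (dfs t @ v) d e = (edges t + M choose e)"
  using assms
proof (induction t arbitrary: v d e M rule: ptree_induct)
  case Leaf
  then show ?case by simp
next
  case (Cons t ts)
  let ?u = "dfs t @ False # dfs (Node ts) @ v"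
  have "rest_count (False # dfs (Node ts) @ v) (Suc d) e = (edges (Node ts) + M choose e)" for e
    using Cons.IH(2)[OF Cons.prems] by (simp del: dfs.simps edges.simps)
  from Cons.IH(1)[OF this]
  have "rest_count ?u (Suc d) e = (edges t + (edges (Node ts) + M) choose e)" for e .
  then show ?case
    unfolding dfs_Cons edges_simps
    by (cases e) (simp_all add: add.assoc del: dfs.simps edges.simps)
qed

lemma first_count_dfs:
  assumes "\<And>e. first_count v d e = (M choose (N + e))"
  shows "first_count (dfs t @ v) d e = (edges t + M choose (edges t + N + e))"
  using assms
proof (induction t arbitrary: v d e M N rule: ptree_induct)
  case Leaf
  then show ?case by simp
next
  case (Cons t ts)
  let ?u = "dfs t @ False # dfs (Node ts) @ v"
  have "first_count (False # dfs (Node ts) @ v) (Suc d) e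
      = (edges (Node ts) + M choose (edges (Node ts) + N + e))" for e
    using Cons.IH(2)[OF Cons.prems] by (simp del: dfs.simps edges.simps)
  from Cons.IH(1)[OF this, unfolded add.assoc[symmetric]]
  have "first_count ?u (Suc d) e
      = (edges t + edges (Node ts) + M choose (edges t + edges (Node ts) + N + e))" for e .
  then show ?case
    unfolding dfs_Cons edges_simps by (simp del: dfs.simps edges.simps)
qed

text \<open>A word of this form lets the rest of a block end immediately at depth zero.\<close>

abbreviation stops :: "bool list \<Rightarrow> bool" where
  "stops v \<equiv> v = [] \<or> hd v = False"

lemma block_count_dfs:
  assumes "stops v"
  shows "block_count (dfs t @ False # dfs (Node ts) @ v)
    = (Suc (edges t) + edges (Node ts) choose Suc (edges t))"
proof -
  have "rest_count v 0 e = (0 choose e)" for e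
    using assms by (cases v; cases e) auto
  from rest_count_dfs[OF this]
  have "first_count (False # dfs (Node ts) @ v) 0 e = (edges (Node ts) choose (0 + e))" for e
    by (simp del: dfs.simps edges.simps)
  from first_count_dfs[OF this]
  show ?thesis by (simp add: block_count_def del: dfs.simps edges.simps)
qed

lemma total_count_dfs:
  assumes "stops v"
  shows "total_count (dfs t @ v) = num_linear_extensions t * total_count v"
  using assms
proof (induction t arbitrary: v rule: ptree_induct)
  case Leaf
  then show ?case by (simp add: num_linear_extensions_Nil)
next
  case (Cons t ts)
  show ?case
    unfolding dfs_Cons num_linear_extensions_Cons
    using Cons.IH(1)[of "False # dfs (Node ts) @ v"] Cons.IH(2)[OF Cons.prems]
      block_count_dfs[OF Cons.prems]
    by (simp add: mult.assoc del: dfs.simps edges.simps)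
qed

theorem theorem3p18:
  shows "extend_by_zero dfs num_linear_extensions \<in> sharpL"
proof (rule sharpL_program[of program Scan 3])
  fix x
  have "extend_by_zero dfs num_linear_extensions x = of_bool (balanced x 0) * total_count x"
  proof (cases "x \<in> range dfs")
    case True
    then obtain t where x: "x = dfs t" by blast
    then show ?thesis
      using True total_count_dfs[of "[]" t]
      by (simp add: balanced_iff extend_by_zero_enc inj_dfs)
  qed (simp add: extend_by_zero_def balanced_iff)
  then show "program_counts program x (length x) Scan 0 (replicate 3 0) (extend_by_zero dfs num_linear_extensions x)"
    using program_counts_program by simp
qed

end
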